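(* Consider all pairs $(A,V)$ with $A$ cyclic of odd order acting faithfully and $\mathbf F_2$-linearly on $V=\mathbf F_2^n$ with $C_V(A)=0$, and the condition $$(\ast)\quad\text{some sub-multiset of the multiset of $A$-orbit sizes on $V$ sums to }\tfrac12|V| .$$ Condition $(\ast)$ first occurs at $n=7$ (it holds for no such pair with $n\le6$ and for some pair with $n=7$), and for $n=7$ it occurs only for $|A|=21$ and $$V\cong\mathbf F_4\oplus\mathbf F_4\oplus\mathbf F_8=\mathbf F_4^2\oplus\mathbf F_8,$$ with a generator of $A$ acting on the three summands with orders $3,3,7$ respectively. The $A$-orbit sizes on $V$ are then $$1,\ 3,3,3,3,3,\ 7,\ 21,21,21,21,21,$$ and the sub-multisets summing to $64$ (counted as sub-collections of the twelve orbits) are exactly the $20$ of the forms $1+21+21+21$ and $3+3+3+3+3+7+21+21$.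
   Context: $C_V(A)$ is the subspace of vectors fixed by all of $A$. The summands in the decomposition of $V$ are irreducible $\mathbf F_2[A]$-submodules. *)

theory Defs
  imports
    "Jordan_Normal_Form.Matrix"
    "HOL-Algebra.Group_Action"
    "HOL-Algebra.Elementary_Groups"
    "HOL-Algebra.Multiplicative_Group"
    "HOL-Library.Z2"
    "HOL-Library.Multiset"
begin

text \<open>
  The field with two elements is the type \<^typ>\<open>bit\<close>, and the space of column vectors of
  dimension n over it is \<open>carrier_vec n\<close>, so that n is an ordinary natural number
  (possibly 0). An action of A is a homomorphism \<open>\<phi>\<close> into the group of permutations of
  this set.
\<close>

abbreviation F2_space :: "nat \<Rightarrow> bit vec set" where
  "F2_space n \<equiv> carrier_vec n"

definition linear_action :: "'a monoid \<Rightarrow> nat \<Rightarrow> ('a \<Rightarrow> bit vec \<Rightarrow> bit vec) \<Rightarrow> bool" where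
  "linear_action A n \<phi> \<longleftrightarrow>
     (\<forall>a \<in> carrier A.
        (\<forall>v \<in> F2_space n. \<forall>w \<in> F2_space n. \<phi> a (v + w) = \<phi> a v + \<phi> a w) \<and>
        (\<forall>c. \<forall>v \<in> F2_space n. \<phi> a (c \<cdot>\<^sub>v v) = c \<cdot>\<^sub>v \<phi> a v))"

definition fixed_space :: "'a monoid \<Rightarrow> nat \<Rightarrow> ('a \<Rightarrow> bit vec \<Rightarrow> bit vec) \<Rightarrow> bit vec set" where
  "fixed_space A n \<phi> = {v \<in> F2_space n. \<forall>a \<in> carrier A. \<phi> a v = v}"

text \<open>
  Since \<open>order A\<close> is 0 for infinite A, odd order includes finiteness.
\<close>

definition cyclic_odd_pair :: "'a monoid \<Rightarrow> nat \<Rightarrow> ('a \<Rightarrow> bit vec \<Rightarrow> bit vec) \<Rightarrow> bool" where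
  "cyclic_odd_pair A n \<phi> \<longleftrightarrow>
     group A \<and> cyclic_group A \<and> odd (order A) \<and>
     faithful_action A (F2_space n) \<phi> \<and> linear_action A n \<phi> \<and>
     fixed_space A n \<phi> = {0\<^sub>v n}"

definition orbit_sizes :: "'a monoid \<Rightarrow> nat \<Rightarrow> ('a \<Rightarrow> bit vec \<Rightarrow> bit vec) \<Rightarrow> nat multiset" where
  "orbit_sizes A n \<phi> = image_mset card (mset_set (orbits A (F2_space n) \<phi>))"

definition half_sum_condition :: "'a monoid \<Rightarrow> nat \<Rightarrow> ('a \<Rightarrow> bit vec \<Rightarrow> bit vec) \<Rightarrow> bool" where
  "half_sum_condition A n \<phi> \<longleftrightarrow>
     (\<exists>S. S \<subseteq># orbit_sizes A n \<phi> \<and> real (sum_mset S) = real (card (F2_space n)) / 2)"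

definition submodule_of_action ::
    "'a monoid \<Rightarrow> nat \<Rightarrow> ('a \<Rightarrow> bit vec \<Rightarrow> bit vec) \<Rightarrow> bit vec set \<Rightarrow> bool" where
  "submodule_of_action A n \<phi> U \<longleftrightarrow>
     U \<subseteq> F2_space n \<and> 0\<^sub>v n \<in> U \<and>
     (\<forall>u \<in> U. \<forall>w \<in> U. u + w \<in> U) \<and>
     (\<forall>c. \<forall>u \<in> U. c \<cdot>\<^sub>v u \<in> U) \<and>
     (\<forall>a \<in> carrier A. \<forall>u \<in> U. \<phi> a u \<in> U)"

definition irreducible_submodule ::
    "'a monoid \<Rightarrow> nat \<Rightarrow> ('a \<Rightarrow> bit vec \<Rightarrow> bit vec) \<Rightarrow> bit vec set \<Rightarrow> bool" where
  "irreducible_submodule A n \<phi> U \<longleftrightarrow>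
     submodule_of_action A n \<phi> U \<and> U \<noteq> {0\<^sub>v n} \<and>
     (\<forall>W. submodule_of_action A n \<phi> W \<and> W \<subseteq> U \<longrightarrow> W = {0\<^sub>v n} \<or> W = U)"

text \<open>
  U is isomorphic, as a module, to the finite field with q elements, on which each element of
  A acts as multiplication by some field element. Every finite field has a copy with carrier
  in \<^typ>\<open>nat\<close>, and all fields with q elements are isomorphic, so the choice of K is immaterial.
  An additive map between these spaces is automatically linear over the prime field.
\<close>

definition iso_to_GF ::
    "nat \<Rightarrow> 'a monoid \<Rightarrow> ('a \<Rightarrow> bit vec \<Rightarrow> bit vec) \<Rightarrow> bit vec set \<Rightarrow> bool" where
  "iso_to_GF q A \<phi> U \<longleftrightarrow>
     (\<exists>(K :: nat ring) f.
        field K \<and> order K = q \<and> bij_betw f U (carrier K) \<and>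
        (\<forall>u \<in> U. \<forall>w \<in> U. f (u + w) = f u \<oplus>\<^bsub>K\<^esub> f w) \<and>
        (\<forall>a \<in> carrier A. \<exists>c \<in> carrier K. \<forall>u \<in> U. f (\<phi> a u) = c \<otimes>\<^bsub>K\<^esub> f u))"

definition order_on ::
    "('a \<Rightarrow> bit vec \<Rightarrow> bit vec) \<Rightarrow> 'a \<Rightarrow> bit vec set \<Rightarrow> nat" where
  "order_on \<phi> g U = group.ord (BijGroup U) (restrict (\<phi> g) U)"

definition direct_sum3 ::
    "bit vec set \<Rightarrow> bit vec set \<Rightarrow> bit vec set \<Rightarrow> bit vec set \<Rightarrow> bool" where
  "direct_sum3 V U1 U2 U3 \<longleftrightarrow>
     bij_betw (\<lambda>(u1, u2, u3). u1 + u2 + u3) (U1 \<times> U2 \<times> U3) V"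

definition F4_F4_F8_decomposition ::
    "'a monoid \<Rightarrow> nat \<Rightarrow> ('a \<Rightarrow> bit vec \<Rightarrow> bit vec) \<Rightarrow> bool" where
  "F4_F4_F8_decomposition A n \<phi> \<longleftrightarrow>
     (\<exists>U1 U2 U3 g.
        irreducible_submodule A n \<phi> U1 \<and> irreducible_submodule A n \<phi> U2 \<and>
        irreducible_submodule A n \<phi> U3 \<and> direct_sum3 (F2_space n) U1 U2 U3 \<and>
        iso_to_GF 4 A \<phi> U1 \<and> iso_to_GF 4 A \<phi> U2 \<and> iso_to_GF 8 A \<phi> U3 \<and>
        g \<in> carrier A \<and> generate A {g} = carrier A \<and>
        order_on \<phi> g U1 = 3 \<and> order_on \<phi> g U2 = 3 \<and> order_on \<phi> g U3 = 7)"

end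

theory Submission
  imports
    Defs
    "HOL-Computational_Algebra.Primes"
    "HOL-Algebra.Weak_Morphisms"
begin

text \<open>
  Condition \<open>(\<ast>)\<close> says that there is an invariant subset X of V with half of its elements. Let p
  be a prime divisor of \<open>m = |A|\<close>, let q be the exact power of p in m, and let D be the space
  fixed by the subgroup of order p. Orbits outside D have size divisible by q, so, D having
  dimension j, q divides \<open>2\<^sup>n\<^sup>-\<^sup>j - 1\<close> and \<open>|X| \<equiv> |X \<inter> D|\<close> modulo p. Nonzero vectors have orbits
  of odd size at least 3, so an invariant set of nonzero vectors never has 1, 2 or 4 elements;
  applied to \<open>X \<inter> D - {0}\<close>, to \<open>D - X - {0}\<close> and to \<open>D - {0}\<close>, this leaves for \<open>n \<le> 7\<close> only \<open>p = 3\<close>,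
  and \<open>p = 7\<close> when \<open>n = 7\<close>. If 3 were the only prime, then \<open>|V| \<equiv> 1\<close> would be twice 0 or 1
  modulo 3; the same divisibilities exclude \<open>m = 7\<close> and the squares of 3 and 7. For
  \<open>m = 21\<close> and \<open>n = 7\<close> they also force 16 vectors fixed by \<open>g\<^sup>3\<close> and 8 fixed by \<open>g\<^sup>7\<close>, g being a
  generator, and hence the orbit sizes.
\<close>

section \<open>Vector spaces over the field with two elements\<close>

lemma finite_F2_space: "finite (F2_space n)"
  and card_F2_space: "card (F2_space n) = 2 ^ n"
proof -
  have bij: "bij_betw (vec n) ({..<n} \<rightarrow>\<^sub>E (UNIV :: bit set)) (F2_space n)"
  proof (rule bij_betwI[where g = "\<lambda>v. \<lambda>i\<in>{..<n}. v $ i"])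
    show "(\<lambda>v. \<lambda>i\<in>{..<n}. v $ i) \<in> F2_space n \<rightarrow> {..<n} \<rightarrow>\<^sub>E (UNIV :: bit set)" by auto
    show "(\<lambda>i\<in>{..<n}. vec n f $ i) = f" if "f \<in> {..<n} \<rightarrow>\<^sub>E (UNIV :: bit set)" for f
      using that by (auto simp: fun_eq_iff PiE_def extensional_def)
    show "vec n (\<lambda>i\<in>{..<n}. v $ i) = v" if "v \<in> F2_space n" for v
      using that by auto
  qed auto
  have UNIV: "(UNIV :: bit set) = {0, 1}"
    by (auto simp: bit_not_zero_iff)
  show "finite (F2_space n)"
    using bij_betw_finite[OF bij] by (simp add: UNIV finite_PiE)
  have "card (UNIV :: bit set) = 2"
    by (simp add: UNIV)
  then show "card (F2_space n) = 2 ^ n"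
    using bij_betw_same_card[OF bij] by (simp add: card_PiE)
qed

lemma F2_vec_add_self: "v \<in> F2_space n \<Longrightarrow> v + v = 0\<^sub>v n"
  by (rule eq_vecI) auto

lemma F2_add_eq_zero_iff:
  assumes "v \<in> F2_space n" "w \<in> F2_space n"
  shows "v + w = 0\<^sub>v n \<longleftrightarrow> v = w"
proof
  assume "v + w = 0\<^sub>v n"
  then have "v + (w + w) = 0\<^sub>v n + w"
    using assms by (simp flip: assoc_add_vec[of _ n])
  then show "v = w"
    using assms by (simp add: F2_vec_add_self)
qed (use assms F2_vec_add_self in auto)

text \<open>Over the field with two elements the scalars are 0 and 1, so these conditions describe
  exactly the linear subspaces.\<close>

definition F2_subspace :: "nat \<Rightarrow> bit vec set \<Rightarrow> bool" where
  "F2_subspace n U \<longleftrightarrow> U \<subseteq> F2_space n \<and> 0\<^sub>v n \<in> U \<and> (\<forall>u \<in> U. \<forall>w \<in> U. u + w \<in> U)"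

text \<open>Every vector is its own negative, so closure under addition gives closure under
  inverses.\<close>

lemma F2_subspace_subgroup:
  assumes "F2_subspace n U"
  shows "subgroup U (monoid_vec TYPE(bit) n)"
proof -
  interpret comm_group "monoid_vec TYPE(bit) n" by (rule comm_group_vec)
  have inv: "inv\<^bsub>monoid_vec TYPE(bit) n\<^esub> u = u" if "u \<in> F2_space n" for u
    by (rule inv_equality) (use that F2_vec_add_self in \<open>auto simp: monoid_vec_simps\<close>)
  show ?thesis
    using assms inv by (auto simp: F2_subspace_def subgroup_def monoid_vec_simps subset_iff)
qed

text \<open>By Lagrange the cardinality divides \<open>2 ^ n\<close>, and the divisors of a prime
  power are powers of that prime.\<close>

lemma F2_subspace_card:
  assumes "F2_subspace n U"
  obtains j where "card U = 2 ^ j" "j \<le> n"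
proof -
  interpret comm_group "monoid_vec TYPE(bit) n" by (rule comm_group_vec)
  have "card U dvd 2 ^ n"
    using lagrange[OF F2_subspace_subgroup[OF assms]]
    by (simp add: order_def monoid_vec_simps card_F2_space flip: dvd_triv_right) (metis dvd_triv_right)
  then obtain j where "card U = 2 ^ j" "j \<le> n"
    using divides_primepow_nat[of 2] by auto
  then show thesis by (rule that)
qed

section \<open>Arithmetic of orbit sizes\<close>

text \<open>Each term is at least 3. A single term is odd, hence not 2 or 4; two terms already sum
  to at least 6.\<close>

lemma sum_odd_ge_3:
  fixes f :: "'b \<Rightarrow> nat"
  assumes "finite I" "\<And>i. i \<in> I \<Longrightarrow> odd (f i)" "\<And>i. i \<in> I \<Longrightarrow> f i \<noteq> 1"
  shows "sum f I \<notin> {1, 2, 4}"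
proof -
  have ge: "3 \<le> f i" if "i \<in> I" for i
    using assms(2,3)[OF that] by (cases "f i = 0"; cases "f i = 2") auto
  consider "card I = 0" | i where "I = {i}" | "card I \<ge> 2"
    by (metis One_nat_def card_1_singletonE less_2_cases not_less)
  then show ?thesis
  proof cases
    case 1
    with assms(1) show ?thesis by simp
  next
    case 2
    with assms ge[of i] show ?thesis by auto
  next
    case 3
    have "card I * 3 \<le> sum f I"
      using sum_bounded_below[of I 3 f] ge by simp
    with 3 show ?thesis by auto
  qed
qed

text \<open>Write \<open>m = e * k\<close>. If p divided k, then e would divide
  \<open>m div p\<close>; so k is prime to p, and the full power of p in m divides e.\<close>

lemma multiplicity_dvd_of_not_dvd_div:
  fixes p e m :: nat
  assumes "prime p" "m > 0" "p dvd m" "e dvd m" "\<not> e dvd m div p"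
  shows "p ^ multiplicity p m dvd e"
proof -
  obtain k where k: "m = e * k" using assms(4) by blast
  have "\<not> p dvd k"
  proof
    assume "p dvd k"
    then obtain l where "k = p * l" by blast
    with k assms have "m div p = e * l"
      by (metis mult.left_commute nonzero_mult_div_cancel_left not_prime_0)
    with assms(5) show False by simp
  qed
  then have "coprime (p ^ multiplicity p m) k"
    using assms(1) by (simp add: prime_imp_coprime)
  moreover have "p ^ multiplicity p m dvd e * k"
    using k multiplicity_dvd by metis
  ultimately show ?thesis
    by (simp add: coprime_dvd_mult_left_iff)
qed

section \<open>Invariant sets and fixed spaces\<close>

text \<open>A generator is fixed once and for all, so that the action becomes the iteration of the
  single permutation \<open>\<phi> g\<close>.\<close>

locale cyclic_odd_action = faithful_action A "F2_space n" \<phi>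
  for A :: "'a monoid" (structure) and n \<phi> +
  fixes g
  assumes odd_order: "odd (order A)"
    and linear: "linear_action A n \<phi>"
    and fixed: "fixed_space A n \<phi> = {0\<^sub>v n}"
    and g_closed: "g \<in> carrier A"
    and g_gen: "subgroup_generated A {g} = A"
begin

lemma cyclic: "cyclic_group A"
  using g_closed g_gen by (auto simp: cyclic_group_def)

sublocale comm_group A
  by (rule group.cyclic_imp_abelian_group[OF group_hom.axioms(1)[OF group_hom] cyclic])

lemma order_pos: "order A > 0"
  using odd_order by (rule odd_pos)

lemma finite_carrier: "finite (carrier A)"
  using order_pos order_gt_0_iff_finite by blast

lemma generate_g: "generate A {g} = carrier A"
  by (metis carrier_subgroup_generated_subset g_gen carrier_subgroup_generated g_closed
      Int_insert_right_if1 Int_empty_right)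

lemma carrier_eq: "carrier A = range (\<lambda>i::nat. g [^] i)"
  using generate_pow_on_finite_carrier[OF finite_carrier g_closed] generate_g by auto

lemma action_closed: "a \<in> carrier A \<Longrightarrow> v \<in> F2_space n \<Longrightarrow> \<phi> a v \<in> F2_space n"
  using element_image by blast

lemma action_add:
  "a \<in> carrier A \<Longrightarrow> v \<in> F2_space n \<Longrightarrow> w \<in> F2_space n \<Longrightarrow> \<phi> a (v + w) = \<phi> a v + \<phi> a w"
  using linear by (simp add: linear_action_def)

lemma action_zero: "a \<in> carrier A \<Longrightarrow> \<phi> a (0\<^sub>v n) = 0\<^sub>v n"
  using fixed by (auto simp: fixed_space_def)

lemma action_one: "v \<in> F2_space n \<Longrightarrow> \<phi> \<one> v = v"
  by (metis id_eq_one restrict_apply')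

lemma action_comm:
  "a \<in> carrier A \<Longrightarrow> b \<in> carrier A \<Longrightarrow> v \<in> F2_space n \<Longrightarrow> \<phi> a (\<phi> b v) = \<phi> b (\<phi> a v)"
  by (metis composition_rule m_comm)

lemma action_pow_add:
  fixes i j :: nat
  shows "v \<in> F2_space n \<Longrightarrow> \<phi> (g [^] (i + j)) v = \<phi> (g [^] i) (\<phi> (g [^] j) v)"
  by (simp add: composition_rule g_closed flip: nat_pow_mult)

text \<open>The orbit of v is a cycle of \<open>\<phi> g\<close>. Its length is the least positive
  period d of v, and the exponents that fix v are the multiples of d. This translates between fixed
  spaces and orbit sizes.\<close>

lemma fixed_iff_dvd:
  assumes v: "v \<in> F2_space n"
  shows "\<phi> (g [^] (k :: nat)) v = v \<longleftrightarrow> card (orbit A \<phi> v) dvd k"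
proof -
  let ?P = "\<lambda>i::nat. \<phi> (g [^] i) v = v"
  define d where "d = (LEAST d. 0 < d \<and> ?P d)"
  have "0 < order A \<and> ?P (order A)"
    using order_pos v by (simp add: pow_order_eq_1 g_closed action_one)
  then have d: "0 < d" "?P d"
    unfolding d_def by (metis (mono_tags, lifting) LeastI)+
  have d_least: "d \<le> i" if "0 < i" "?P i" for i
    unfolding d_def using that by (simp add: Least_le)
  have mult: "?P (d * q)" for q
    by (induction q) (use v d in \<open>simp_all add: action_pow_add action_one\<close>)
  have reduce: "\<phi> (g [^] i) v = \<phi> (g [^] (i mod d)) v" for i :: nat
    using action_pow_add[OF v, of "i mod d" "d * (i div d)"] mult by simp
  \<comment> \<open>Cancelling \<open>\<phi> (g [^] i)\<close>, a coincidence of two powers below d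
    would give a positive period below d.\<close>
  have inj: "inj_on (\<lambda>i::nat. \<phi> (g [^] i) v) {..<d}"
  proof (rule linorder_inj_onI')
    fix i j assume ij: "i \<in> {..<d}" "j \<in> {..<d}" "i < j"
    show "\<phi> (g [^] i) v \<noteq> \<phi> (g [^] j) v"
    proof
      assume "\<phi> (g [^] i) v = \<phi> (g [^] j) v"
      also have "\<dots> = \<phi> (g [^] i) (\<phi> (g [^] (j - i)) v)"
        using action_pow_add[OF v, of i "j - i"] ij by simp
      finally have "?P (j - i)"
        using inj_prop[of "g [^] i"] v action_closed g_closed by (auto simp: inj_on_def)
      with d_least[of "j - i"] ij show False by auto
    qed
  qed
  have "orbit A \<phi> v = range (\<lambda>i::nat. \<phi> (g [^] i) v)"
    by (auto simp: orbit_def carrier_eq)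
  also have "\<dots> = (\<lambda>i::nat. \<phi> (g [^] i) v) ` {..<d}"
  proof -
    have "\<phi> (g [^] i) v \<in> (\<lambda>i::nat. \<phi> (g [^] i) v) ` {..<d}" for i :: nat
      using reduce[of i] d by (intro image_eqI[of _ _ "i mod d"]) auto
    then show ?thesis by auto
  qed
  finally have card: "card (orbit A \<phi> v) = d"
    using inj by (simp add: card_image)
  show ?thesis
  proof
    assume "?P k"
    then have "?P (k mod d)" using reduce by simp
    then have "k mod d = 0" using d_least[of "k mod d"] d(1) by (meson gr0I mod_less_divisor not_le)
    then show "card (orbit A \<phi> v) dvd k" using card by auto
  qed (use mult card in auto)
qed

section \<open>Invariant sets and their cardinalities\<close>

text \<open>Invariant sets are the unions of orbits; they replace the sub-multisets of orbit sizes
  in the arguments below.\<close>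

definition invariant :: "bit vec set \<Rightarrow> bool" where
  "invariant Y \<longleftrightarrow> Y \<subseteq> F2_space n \<and> (\<forall>a \<in> carrier A. \<forall>v \<in> Y. \<phi> a v \<in> Y)"

lemma invariant_finite: "invariant Y \<Longrightarrow> finite Y"
  using finite_F2_space finite_subset by (auto simp: invariant_def)

lemma invariant_orbits: "invariant Y \<Longrightarrow> \<Union> (orbit A \<phi> ` Y) = Y"
  unfolding invariant_def by (auto simp: orbit_def) (metis action_one one_closed subsetD)

lemma card_Union_orbits:
  assumes "S \<subseteq> orbits A (F2_space n) \<phi>"
  shows "card (\<Union> S) = (\<Sum>X\<in>S. card X)"
proof (rule card_Union_disjoint)
  show "pairwise disjnt S"
    using disjoint_union assms by (auto simp: pairwise_def disjnt_def)
  show "finite X" if "X \<in> S" for X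
    using that assms orbits_coverture finite_F2_space finite_subset by (metis Sup_upper subset_eq)
qed

lemma invariant_card:
  assumes "invariant Y"
  shows "card Y = (\<Sum>X\<in>orbit A \<phi> ` Y. card X)"
  using card_Union_orbits[of "orbit A \<phi> ` Y"] invariant_orbits[OF assms] assms
  by (auto simp: orbits_def invariant_def)

lemma invariant_dvd_card:
  assumes "invariant Y" "\<And>v. v \<in> Y \<Longrightarrow> q dvd card (orbit A \<phi> v)"
  shows "q dvd card Y"
  using assms by (auto simp: invariant_card intro!: dvd_sum)

lemma orbit_card_dvd: "v \<in> F2_space n \<Longrightarrow> card (orbit A \<phi> v) dvd order A"
  by (metis dvd_triv_left orbit_stabilizer_theorem)

lemma orbit_card_odd: "v \<in> F2_space n \<Longrightarrow> odd (card (orbit A \<phi> v))"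
  using orbit_card_dvd odd_order dvd_trans by blast

text \<open>A vector with a one-element orbit is fixed by every power of g, hence by A, and the
  fixed space is zero.\<close>

lemma orbit_card_neq_1:
  assumes "v \<in> F2_space n" "v \<noteq> 0\<^sub>v n"
  shows "card (orbit A \<phi> v) \<noteq> 1"
proof
  assume "card (orbit A \<phi> v) = 1"
  then have "\<phi> (g [^] i) v = v" for i :: nat
    using fixed_iff_dvd assms by simp
  then have "v \<in> fixed_space A n \<phi>"
    using assms by (auto simp: fixed_space_def carrier_eq)
  with fixed assms show False by simp
qed

lemma invariant_card_notin:
  assumes "invariant Y" "0\<^sub>v n \<notin> Y"
  shows "card Y \<notin> {1, 2, 4}"
  unfolding invariant_card[OF assms(1)]
proof (rule sum_odd_ge_3)
  show "finite (orbit A \<phi> ` Y)" using invariant_finite[OF assms(1)] by simp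
qed (use assms orbit_card_odd orbit_card_neq_1 in \<open>auto simp: invariant_def subset_iff\<close>)

section \<open>Fixed spaces of powers of the generator\<close>

text \<open>For k equal to \<open>order A div p\<close>, with p a prime divisor of the order,
  \<open>g [^] k\<close> generates the subgroup of order p, and this is the space fixed by that
  subgroup.\<close>

definition Fix :: "nat \<Rightarrow> bit vec set" where
  "Fix k = {v \<in> F2_space n. \<phi> (g [^] k) v = v}"

lemma Fix_invariant: "invariant (Fix k)"
  unfolding invariant_def Fix_def using action_comm action_closed g_closed by auto

lemma Fix_iff: "v \<in> Fix k \<longleftrightarrow> v \<in> F2_space n \<and> card (orbit A \<phi> v) dvd k"
  using fixed_iff_dvd by (auto simp: Fix_def)

lemma Fix_subspace: "F2_subspace n (Fix k)"
  using action_add action_zero g_closed by (auto simp: F2_subspace_def Fix_def)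

lemma zero_in_Fix: "0\<^sub>v n \<in> Fix k"
  using Fix_subspace by (simp add: F2_subspace_def)

lemma invariant_Int: "invariant X \<Longrightarrow> invariant Y \<Longrightarrow> invariant (X \<inter> Y)"
  by (auto simp: invariant_def)

lemma invariant_Diff: 
  assumes "invariant X" "invariant Y" shows "invariant (X - Y)"
  unfolding invariant_def
proof safe
  fix v a assume v: "v \<in> X" "v \<notin> Y" "a \<in> carrier A" "\<phi> a v \<in> Y"
  then have "\<phi> (inv a) (\<phi> a v) \<in> Y" using assms by (auto simp: invariant_def)
  moreover have "\<phi> (inv a) (\<phi> a v) = v"
    using orbit_sym_aux v assms by (auto simp: invariant_def)
  ultimately show False using v by simp
qed (use assms in \<open>auto simp: invariant_def\<close>)

lemma invariant_zero: "invariant {0\<^sub>v n}"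
  using action_zero by (auto simp: invariant_def)

lemma invariant_space: "invariant (F2_space n)"
  using action_closed by (auto simp: invariant_def)

text \<open>Dimension 1 is impossible: the only nonzero vector would form an invariant set with one
  element.\<close>

lemma Fix_card:
  obtains j where "card (Fix k) = 2 ^ j" "j \<le> n" "j \<noteq> 1"
proof -
  obtain j where j: "card (Fix k) = 2 ^ j" "j \<le> n"
    using F2_subspace_card[OF Fix_subspace] by metis
  have "card (Fix k - {0\<^sub>v n}) = card (Fix k) - 1"
    using zero_in_Fix by (simp add: card_Diff_subset)
  with invariant_card_notin[of "Fix k - {0\<^sub>v n}"] j
  have "j \<noteq> 1" by (auto simp: invariant_Diff Fix_invariant invariant_zero)
  with j that show thesis by blast
qed

end

section \<open>Invariant sets with half of the vectors\<close>

text \<open>The numbers \<open>2 ^ i - 1\<close> for i from 1 to 7 are 1, 3, 7, 3 * 5, 31, 3 * 3 * 7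
  and 127; the pairs are read off from these factorizations.\<close>

lemma prime_dvd_mersenne:
  fixes p i :: nat
  assumes "prime p" "p dvd 2 ^ i - 1" "0 < i" "i \<le> 7"
  shows "(p, i) \<in> {(3, 2), (7, 3), (3, 4), (5, 4), (31, 5), (3, 6), (7, 6), (127, 7)}"
proof -
  have factor: "p = q" if "prime q" "p dvd q" for q
    using that assms(1) primes_dvd_imp_eq by blast
  have primes: "prime (3 :: nat)" "prime (5 :: nat)" "prime (7 :: nat)" "prime (31 :: nat)"
    "prime (127 :: nat)"
    by simp_all
  consider "i = 1" | "i = 2" | "i = 3" | "i = 4" | "i = 5" | "i = 6" | "i = 7"
    using assms(3,4) by linarith
  then show ?thesis
  proof cases
    case 1
    with assms show ?thesis by simp
  next
    case 2
    with assms have "p dvd 3" by simp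
    with 2 factor primes show ?thesis by blast
  next
    case 3
    with assms have "p dvd 7" by simp
    with 3 factor primes show ?thesis by blast
  next
    case 4
    with assms have "p dvd 3 * 5" by simp
    with 4 factor primes assms(1) show ?thesis by (metis insertCI prime_dvd_mult_iff)
  next
    case 5
    with assms have "p dvd 31" by simp
    with 5 factor primes show ?thesis by blast
  next
    case 6
    with assms have "p dvd 3 * (3 * 7)" by simp
    with 6 factor primes assms(1) show ?thesis by (metis insertCI prime_dvd_mult_iff)
  next
    case 7
    with assms have "p dvd 127" by simp
    with 7 factor primes show ?thesis by blast
  qed
qed

text \<open>Here j and i stand for the dimension and codimension of the space D fixed by the
  subgroup of order p, z records whether X contains 0, t counts the nonzero vectors of X in D, and
  \<open>p * k\<close> those of X outside D. For j at most 3 the excluded values leave only t = 0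
  and t = \<open>2 ^ j - 1\<close>, and \<open>half\<close> then fails modulo each p other than
  those in the conclusion.\<close>

lemma half_sum_prime_cases:
  fixes p i j z t k :: nat
  assumes "prime p" "p dvd 2 ^ i - 1" "0 < i" "i + j \<le> 7" "j \<noteq> 1"
    and half: "2 ^ (i + j) = 2 * (z + t + p * k)"
    and z: "z \<le> 1"
    and t: "t \<notin> {1, 2, 4}" "t \<le> 2 ^ j - 1" "2 ^ j - 1 - t \<notin> {1, 2, 4}"
  shows "p = 3 \<or> p = 7 \<and> i + j = 7"
proof (rule ccontr)
  assume neg: "\<not> ?thesis"
  consider "j = 0" | "j = 2" | "j = 3" | "j \<ge> 4"
    using assms(5) by linarith
  then show False
  proof cases
    case 1
    with t have "t = 0" by simp
    with 1 prime_dvd_mersenne[OF assms(1-3)] assms(4) half z neg show False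
      by (auto; presburger)
  next
    case 2
    with t have "t = 0 \<or> t = 3" by auto
    with 2 prime_dvd_mersenne[OF assms(1-3)] assms(4) half z neg show False
      by (auto; presburger)
  next
    case 3
    with t have "t = 0 \<or> t = 7" by auto
    with 3 prime_dvd_mersenne[OF assms(1-3)] assms(4) half z neg show False
      by (auto; presburger)
  next
    \<comment> \<open>Now i is at most 3, so p is 3, or p is 7 with i = 3; the latter forces j = 4
      and i + j = 7.\<close>
    case 4
    with prime_dvd_mersenne[OF assms(1-3)] assms(4) neg show False
      by auto
  qed
qed

context cyclic_odd_action
begin

text \<open>A sub-multiset of the orbit sizes is the image of a sub-multiset B of the orbits. Each
  orbit occurs once, so B is a set, and the union of its members is the required invariant
  set.\<close>

lemma half_sum_invariant:
  assumes "half_sum_condition A n \<phi>"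
  obtains X where "invariant X" "2 * card X = 2 ^ n"
proof -
  obtain S where S: "S \<subseteq># orbit_sizes A n \<phi>"
    and half: "real (sum_mset S) = real (card (F2_space n)) / 2"
    using assms by (auto simp: half_sum_condition_def)
  let ?O = "orbits A (F2_space n) \<phi>"
  obtain R where "image_mset card (mset_set ?O) = S + R"
    using S unfolding orbit_sizes_def by (metis mset_subset_eq_exists_conv)
  then obtain B where B: "B \<subseteq># mset_set ?O" "S = image_mset card B"
    by (metis image_mset_eq_plusD mset_subset_eq_add_left)
  have fin: "finite ?O"
    using finite_F2_space by (simp add: orbits_def setcompr_eq_image)
  have set_B: "set_mset B \<subseteq> ?O"
    using set_mset_mono[OF B(1)] fin by simp
  have "B = mset_set (set_mset B)"
  proof (rule multiset_eqI)
    fix X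
    have "count B X \<le> 1"
      using mset_subset_eq_count[OF B(1), of X] fin by (simp add: count_mset_set' split: if_splits)
    then show "count B X = count (mset_set (set_mset B)) X"
      by (cases "X \<in># B") (auto simp: count_mset_set' le_Suc_eq not_in_iff simp flip: count_greater_zero_iff)
  qed
  then have "sum_mset S = (\<Sum>X\<in>set_mset B. card X)"
    using B(2) by (metis sum_unfold_sum_mset)
  also have "\<dots> = card (\<Union> (set_mset B))"
    using card_Union_orbits[OF set_B] by simp
  finally have "real (2 * card (\<Union> (set_mset B))) = real (2 ^ n)"
    using half card_F2_space[of n] by simp
  then have "2 * card (\<Union> (set_mset B)) = 2 ^ n"
    by (simp only: of_nat_eq_iff)
  moreover have "invariant (orbit A \<phi> v)" if "v \<in> F2_space n" for v
    using that action_closed by (auto simp: invariant_def orbit_def) (metis composition_rule m_closed)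
  then have "invariant (\<Union> (set_mset B))"
  proof -
    have "invariant X" if "X \<in> set_mset B" for X
      using that set_B \<open>\<And>v. v \<in> F2_space n \<Longrightarrow> invariant (orbit A \<phi> v)\<close>
      by (auto simp: orbits_def)
    then show ?thesis
      unfolding invariant_def by blast
  qed
  ultimately show thesis by (intro that)
qed

lemma ord_g: "ord g = order A"
  by (simp add: generate_pow_card g_closed generate_g order_def)

text \<open>If \<open>g [^] k\<close> fixed every vector, it would be the identity by faithfulness,
  and the order of g would divide k.\<close>

lemma Fix_proper:
  assumes "0 < k" "k < order A"
  shows "Fix k \<noteq> F2_space n"
proof
  assume eq: "Fix k = F2_space n"
  have "\<phi> (g [^] k) = \<phi> \<one>"
  proof (rule extensionalityI)
    show "\<phi> (g [^] k) \<in> extensional (F2_space n)" "\<phi> \<one> \<in> extensional (F2_space n)"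
      using bij_prop0 g_closed by (auto simp: Bij_def)
    show "\<phi> (g [^] k) v = \<phi> \<one> v" if "v \<in> F2_space n" for v
      using that eq action_one by (auto simp: Fix_def)
  qed
  then have "g [^] k = \<one>"
    using faithful g_closed by (auto simp: inj_on_def)
  then have "order A dvd k"
    using g_closed pow_eq_id ord_g by simp
  with assms show False by (simp add: nat_dvd_not_less)
qed

text \<open>An orbit outside the fixed space has a size that divides \<open>order A\<close> but not
  \<open>order A div p\<close>, so it is divisible by the full power of p in the order.\<close>

lemma sylow_dvd_card:
  assumes "prime p" "p dvd order A" "invariant Y" "Y \<inter> Fix (order A div p) = {}"
  shows "p ^ multiplicity p (order A) dvd card Y"
proof (rule invariant_dvd_card[OF assms(3)])
  fix v assume "v \<in> Y"
  with assms have "v \<in> F2_space n" "v \<notin> Fix (order A div p)"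
    by (auto simp: invariant_def)
  then have "v \<in> F2_space n" "\<not> card (orbit A \<phi> v) dvd order A div p"
    by (auto simp: Fix_iff)
  with assms order_pos orbit_card_dvd show "p ^ multiplicity p (order A) dvd card (orbit A \<phi> v)"
    by (intro multiplicity_dvd_of_not_dvd_div)
qed

text \<open>There are \<open>(2 ^ i - 1) * 2 ^ j\<close> vectors outside the fixed space. The power
  of p divides this number, and p is odd, so it divides the first factor. Faithfulness makes i
  positive.\<close>

lemma Fix_prime_card:
  assumes "prime p" "p dvd order A"
  obtains i j where "card (Fix (order A div p)) = 2 ^ j" "i + j = n" "0 < i" "j \<noteq> 1"
    "p ^ multiplicity p (order A) dvd 2 ^ i - 1"
proof -
  let ?F = "Fix (order A div p)"
  obtain j where j: "card ?F = 2 ^ j" "j \<le> n" "j \<noteq> 1"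
    by (rule Fix_card)
  define i where "i = n - j"
  have sub: "?F \<subseteq> F2_space n" by (auto simp: Fix_def)
  have "order A div p < order A" "0 < order A div p"
    using assms order_pos by (auto simp: dvd_div_eq_0_iff intro!: Nat.gr0I div_less_dividend prime_gt_1_nat)
  then have "?F \<subset> F2_space n"
    using Fix_proper sub by blast
  then have "(2 :: nat) ^ j < 2 ^ n"
    using psubset_card_mono[OF finite_F2_space] j card_F2_space by metis
  then have i: "0 < i" "i + j = n"
    using j by (auto simp: i_def)
  have "p ^ multiplicity p (order A) dvd card (F2_space n - ?F)"
    using assms by (intro sylow_dvd_card invariant_Diff invariant_space Fix_invariant) auto
  also have "card (F2_space n - ?F) = 2 ^ n - 2 ^ j"
    using sub j finite_subset[OF sub finite_F2_space] by (simp add: card_Diff_subset card_F2_space)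
  also have "\<dots> = (2 ^ i - 1) * 2 ^ j"
    by (simp add: algebra_simps flip: i(2) power_add)
  finally have "p ^ multiplicity p (order A) dvd (2 ^ i - 1) * 2 ^ j" .
  moreover have "odd p"
    using assms(2) odd_order dvd_trans by blast
  then have "coprime (p ^ multiplicity p (order A)) (2 ^ j)"
    by simp
  ultimately have "p ^ multiplicity p (order A) dvd 2 ^ i - 1"
    by (simp add: coprime_dvd_mult_left_iff)
  with i j that show thesis by blast
qed

text \<open>X is cut into its part in the zero space, its nonzero part in \<open>?F\<close> and its
  part outside \<open>?F\<close>, the last of size divisible by p. The nonzero vectors of
  \<open>?F\<close> inside X and those outside X form invariant sets, so neither number is 1, 2 or
  4.\<close>

lemma half_sum_prime:
  assumes X: "invariant X" "2 * card X = 2 ^ n" and "n \<le> 7" "prime p" "p dvd order A"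
  shows "p = 3 \<or> p = 7 \<and> n = 7"
proof -
  let ?F = "Fix (order A div p)" and ?z = "0\<^sub>v n"
  obtain i j where ij: "card ?F = 2 ^ j" "i + j = n" "0 < i" "j \<noteq> 1"
    "p ^ multiplicity p (order A) dvd 2 ^ i - 1"
    using Fix_prime_card[OF assms(4,5)] by metis
  have p_dvd: "p dvd p ^ multiplicity p (order A)"
    using assms(4,5) order_pos by (simp add: prime_multiplicity_gt_zero_iff dvd_power)
  have fin: "finite X" "finite ?F"
    using X(1) Fix_invariant invariant_finite by blast+
  have "p dvd card (X - ?F)"
    using sylow_dvd_card[OF assms(4,5) invariant_Diff[OF X(1) Fix_invariant]] p_dvd
      dvd_trans by blast
  then obtain k where k: "card (X - ?F) = p * k" ..
  let ?t = "card (X \<inter> (?F - {?z}))"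
  have part: "card X = card (X \<inter> {?z}) + ?t + card (X - ?F)"
  proof -
    have "X = (X \<inter> {?z}) \<union> (X \<inter> (?F - {?z})) \<union> (X - ?F)"
      using zero_in_Fix by blast
    moreover have "card ((X \<inter> {?z}) \<union> (X \<inter> (?F - {?z})) \<union> (X - ?F))
        = card (X \<inter> {?z}) + ?t + card (X - ?F)"
      using fin zero_in_Fix by (subst card_Un_disjoint; (subst card_Un_disjoint)?) auto
    ultimately show ?thesis by simp
  qed
  have inv: "invariant (?F - {?z})"
    by (intro invariant_Diff Fix_invariant invariant_zero)
  have card_F: "card (?F - {?z}) = 2 ^ j - 1"
    using zero_in_Fix ij by (simp add: card_Diff_subset)
  have "card (?F - {?z} - X) = 2 ^ j - 1 - ?t"
    using card_Diff_subset_Int[of "?F - {?z}" X] fin card_F by (simp add: Int_commute)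
  moreover have "card (?F - {?z} - X) \<notin> {1, 2, 4}" "?t \<notin> {1, 2, 4}"
    by (intro invariant_card_notin invariant_Diff[OF inv X(1)] invariant_Int[OF X(1) inv]; simp)+
  moreover have "?t \<le> 2 ^ j - 1"
    unfolding card_F[symmetric] using fin by (intro card_mono) auto
  moreover have "card (X \<inter> {?z}) \<le> 1"
    by (cases "?z \<in> X") auto
  moreover have "2 ^ (i + j) = 2 * (card (X \<inter> {?z}) + ?t + p * k)"
    using X(2) ij(2) part k by simp
  ultimately show ?thesis
    using half_sum_prime_cases[of p i j "card (X \<inter> {?z})" ?t k] ij assms(3,4)
      dvd_trans[OF p_dvd ij(5)] by simp
qed

text \<open>The orbit size of a nonzero vector is not 1, so some prime divides it; that prime
  divides the order of A and must be q.\<close>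

lemma nonzero_dvd_card:
  assumes "\<And>p. prime p \<Longrightarrow> p dvd order A \<Longrightarrow> p = q" "invariant Y" "0\<^sub>v n \<notin> Y"
  shows "q dvd card Y"
proof (rule invariant_dvd_card[OF assms(2)])
  fix v assume "v \<in> Y"
  with assms have v: "v \<in> F2_space n" "v \<noteq> 0\<^sub>v n" by (auto simp: invariant_def)
  then obtain p where "prime p" "p dvd card (orbit A \<phi> v)"
    using orbit_card_neq_1 prime_factor_nat by blast
  moreover from this have "p = q"
    using assms(1) orbit_card_dvd[OF v(1)] dvd_trans by blast
  ultimately show "q dvd card (orbit A \<phi> v)" by simp
qed

text \<open>The only primes that can divide the order are 3 and, for n = 7, also 7. It remains to
  show that both occur, each to the first power.\<close>

lemma half_sum_order:
  assumes "half_sum_condition A n \<phi>" "n \<le> 7"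
  shows "n = 7" "order A = 21"
proof -
  obtain X where X: "invariant X" "2 * card X = 2 ^ n"
    using half_sum_invariant[OF assms(1)] .
  note prime = half_sum_prime[OF X assms(2)]
  let ?z = "0\<^sub>v n"
  have card_V: "card (F2_space n - {?z}) = 2 ^ n - 1"
    by (simp add: card_Diff_subset card_F2_space)
  have inv_V: "invariant (F2_space n - {?z})"
    by (intro invariant_Diff invariant_space invariant_zero)
  \<comment> \<open>Without 7, all nonzero orbits have size divisible by 3, so \<open>2 ^ n\<close>
    is 1 modulo 3; but it is also twice a number that is 0 or 1 modulo 3.\<close>
  have seven: "7 dvd order A"
  proof (rule ccontr)
    assume "\<not> 7 dvd order A"
    with prime have three: "p = 3" if "prime p" "p dvd order A" for p
      using that by blast
    have "3 dvd (2 :: nat) ^ n - 1"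
      using nonzero_dvd_card[OF three inv_V] unfolding card_V by simp
    then obtain a where a: "(2 :: nat) ^ n - 1 = 3 * a" ..
    have "3 dvd card (X - {?z})"
      using nonzero_dvd_card[OF three invariant_Diff[OF X(1) invariant_zero]] by simp
    then obtain b where b: "card (X - {?z}) = 3 * b" ..
    have "card X = card (X - {?z}) \<or> card X = card (X - {?z}) + 1"
      using card_Suc_Diff1[OF invariant_finite[OF X(1)], of ?z] by (cases "?z \<in> X") simp_all
    then have "2 ^ n = 6 * b \<or> 2 ^ n = 6 * b + 2"
      using X(2) b by auto
    moreover have "2 ^ n = 3 * a + 1"
      using a by (metis add.commute le_add_diff_inverse one_le_numeral one_le_power)
    ultimately have "3 * a + 1 = 6 * b \<or> 3 * a + 1 = 6 * b + 2" by simp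
    then show False by presburger
  qed
  then show n: "n = 7"
    using prime[of 7] by simp
  \<comment> \<open>For i from 1 to 7, the square 9 divides \<open>2 ^ i - 1\<close> only if i = 6,
    which leaves the excluded dimension j = 1; 49 divides none of these numbers.\<close>
  have square: "\<not> p\<^sup>2 dvd order A" if p: "prime p" "p = 3 \<or> p = 7" for p
  proof
    assume p2: "p\<^sup>2 dvd order A"
    then have "p dvd order A" by (metis dvd_mult_left power2_eq_square)
    then obtain i j where ij: "i + j = n" "j \<noteq> 1" "0 < i" "p ^ multiplicity p (order A) dvd 2 ^ i - 1"
      using Fix_prime_card[OF p(1)] by metis
    have "2 \<le> multiplicity p (order A)"
      using p2 p(1) order_pos by (intro multiplicity_geI) (auto simp: prime_nat_iff)
    then have "p\<^sup>2 dvd 2 ^ i - 1"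
      using ij(4) le_imp_power_dvd dvd_trans by blast
    moreover have "i \<in> {1, 2, 3, 4, 5, 7}"
      using ij n by auto
    ultimately show False using p(2) by auto
  qed
  \<comment> \<open>With 7 as the only prime, 7 would divide the number 127 of nonzero
    vectors.\<close>
  have "3 dvd order A"
  proof (rule ccontr)
    assume "\<not> 3 dvd order A"
    with prime have "p = 7" if "prime p" "p dvd order A" for p
      using that by blast
    then have "7 dvd card (F2_space n - {?z})"
      using inv_V by (intro nonzero_dvd_card) auto
    then show False unfolding card_V by (simp add: n)
  qed
  with seven have "3 * 7 dvd order A"
    by (intro divides_mult) (simp_all add: prime_imp_coprime)
  then obtain r where r: "order A = 3 * 7 * r" ..
  have "r = 1"
  proof (rule ccontr)
    assume "r \<noteq> 1"
    then obtain p where p: "prime p" "p dvd r" using prime_factor_nat by blast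
    from p(2) have "p dvd order A"
      unfolding r by (rule dvd_mult)
    with prime p(1) have "p = 3 \<or> p = 7" by blast
    moreover from this have "p * p dvd 3 * 7 * r"
      using p(2) by (intro mult_dvd_mono) auto
    then have "p\<^sup>2 dvd order A"
      by (simp only: r power2_eq_square)
    ultimately show False using square p(1) by blast
  qed
  then show "order A = 21" using r by simp
qed

definition orbits_of_size :: "nat \<Rightarrow> bit vec set set" where
  "orbits_of_size c = {X \<in> orbits A (F2_space n) \<phi>. card X = c}"

lemma finite_orbits: "finite (orbits A (F2_space n) \<phi>)"
  using finite_F2_space by (simp add: orbits_def setcompr_eq_image)

lemma finite_orbits_of_size: "finite (orbits_of_size c)"
  using finite_orbits by (simp add: orbits_of_size_def)

lemma card_orbits_of_size:
  "card {v \<in> F2_space n. card (orbit A \<phi> v) = c} = card (orbits_of_size c) * c"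
proof -
  have "\<Union> (orbits_of_size c) = {v \<in> F2_space n. card (orbit A \<phi> v) = c}"
  proof (intro equalityI subsetI)
    fix v assume "v \<in> \<Union> (orbits_of_size c)"
    then obtain w where w: "w \<in> F2_space n" "v \<in> orbit A \<phi> w" "card (orbit A \<phi> w) = c"
      by (auto simp: orbits_of_size_def orbits_def)
    then have v: "v \<in> F2_space n" using action_closed by (auto simp: orbit_def)
    then have "orbit A \<phi> v = orbit A \<phi> w"
      using disjoint_union[of "orbit A \<phi> v" "orbit A \<phi> w"] w orbit_refl[OF v]
      by (auto simp: orbits_def)
    with v w show "v \<in> {v \<in> F2_space n. card (orbit A \<phi> v) = c}" by simp
  qed (use orbit_refl in \<open>auto simp: orbits_of_size_def orbits_def\<close>)
  then show ?thesis
    using card_Union_orbits[of "orbits_of_size c"] by (auto simp: orbits_of_size_def)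
qed

end

section \<open>Orbit sizes of a cyclic group of order 21\<close>

locale order_21_action = cyclic_odd_action A 7 \<phi> g
  for A :: "'a monoid" (structure) and \<phi> g +
  assumes order_21: "order A = 21"
begin

lemma orbit_card_cases:
  assumes "v \<in> F2_space 7"
  shows "card (orbit A \<phi> v) \<in> {1, 3, 7, 21}"
proof -
  have "card (orbit A \<phi> v) dvd 3 * 7"
    using orbit_card_dvd[OF assms] order_21 by simp
  then obtain a b where "card (orbit A \<phi> v) = a * b" "a dvd 3" "b dvd 7"
    using division_decomp by blast
  moreover have "prime (3 :: nat)" "prime (7 :: nat)" by simp_all
  then have "a = 1 \<or> a = 3" "b = 1 \<or> b = 7"
    using \<open>a dvd 3\<close> \<open>b dvd 7\<close> unfolding prime_nat_iff by blast+
  ultimately show ?thesis by auto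
qed

lemma Fix_nonzero_orbit:
  assumes "prime p" "v \<in> Fix p" "v \<noteq> 0\<^sub>v 7"
  shows "card (orbit A \<phi> v) = p"
  using assms orbit_card_neq_1 by (auto simp: Fix_iff prime_nat_iff)

text \<open>The nonzero vectors fixed by \<open>g [^] p\<close> lie in orbits of size exactly
  p.\<close>

lemma prime_dvd_Fix:
  assumes "prime p"
  shows "p dvd card (Fix p) - 1"
proof -
  have "p dvd card (Fix p - {0\<^sub>v 7})"
  proof (rule invariant_dvd_card)
    show "invariant (Fix p - {0\<^sub>v 7})"
      by (intro invariant_Diff Fix_invariant invariant_zero)
    show "p dvd card (orbit A \<phi> v)" if "v \<in> Fix p - {0\<^sub>v 7}" for v
      using that Fix_nonzero_orbit[OF assms, of v] by simp
  qed
  then show ?thesis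
    using zero_in_Fix by (simp add: card_Diff_subset)
qed

lemma Fix_prime_index_card:
  assumes "prime p" "p dvd 21"
  obtains i j where "card (Fix (21 div p)) = 2 ^ j" "i + j = 7" "j \<noteq> 1" "0 < i" "p dvd 2 ^ i - 1"
proof -
  obtain i j where ij: "card (Fix (21 div p)) = 2 ^ j" "i + j = 7" "0 < i" "j \<noteq> 1"
    "p ^ multiplicity p 21 dvd 2 ^ i - 1"
    using Fix_prime_card[of p] assms unfolding order_21 by metis
  moreover have "p dvd p ^ multiplicity p 21"
    using assms by (simp add: prime_multiplicity_gt_zero_iff)
  ultimately show thesis
    using that dvd_trans by blast
qed

text \<open>\<open>g [^] 3\<close> generates the subgroup of order 7. The codimension i is 3 or 6
  because 7 divides \<open>2 ^ i - 1\<close>, and i = 6 would leave j = 1.\<close>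

lemma card_Fix_3: "card (Fix 3) = 16"
proof -
  obtain i j where ij: "card (Fix 3) = 2 ^ j" "i + j = 7" "j \<noteq> 1" "0 < i" "7 dvd 2 ^ i - (1 :: nat)"
    by (rule Fix_prime_index_card[of 7]) auto
  then have "i = 3"
    using prime_dvd_mersenne[of 7 i] by auto
  with ij have "j = 4" by simp
  with ij show ?thesis by simp
qed

text \<open>\<open>g [^] 7\<close> generates the subgroup of order 3, so the codimension is even and
  the dimension is 3 or 5. Dimension 5 fails because 7 does not divide 31.\<close>

lemma card_Fix_7: "card (Fix 7) = 8"
proof -
  obtain i j where ij: "card (Fix 7) = 2 ^ j" "i + j = 7" "j \<noteq> 1" "0 < i" "3 dvd 2 ^ i - (1 :: nat)"
    by (rule Fix_prime_index_card[of 3]) auto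
  then have "i \<in> {2, 4, 6}"
    using prime_dvd_mersenne[of 3 i] by auto
  with ij have "j = 3 \<or> j = 5" by auto
  with ij(1) prime_dvd_Fix[of 7] have "j = 3" by auto
  with ij show ?thesis by simp
qed

lemma Fix_3_Int_Fix_7: "Fix 3 \<inter> Fix 7 = {0\<^sub>v 7}"
proof -
  have "v = 0\<^sub>v 7" if "v \<in> Fix 3" "v \<in> Fix 7" for v
    using Fix_nonzero_orbit[of 3 v] Fix_nonzero_orbit[of 7 v] that by auto
  then show ?thesis using zero_in_Fix by blast
qed

text \<open>\<open>Fix 3\<close> and \<open>Fix 7\<close> have 15 = 5 * 3 and 7 = 1 * 7 nonzero
  vectors and meet in 0; the remaining 128 - 23 = 105 = 5 * 21 vectors lie in orbits of size
  21.\<close>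

lemma card_orbits_of_size_21:
  "card (orbits_of_size 1) = 1" "card (orbits_of_size 3) = 5"
  "card (orbits_of_size 7) = 1" "card (orbits_of_size 21) = 5"
proof -
  let ?z = "0\<^sub>v 7 :: bit vec"
  have fin: "finite (Fix k)" for k
    using invariant_finite[OF Fix_invariant] .
  have zero: "card (orbit A \<phi> ?z) = 1"
    using fixed_iff_dvd[of ?z 1] action_zero g_closed by simp
  have "{v \<in> F2_space 7. card (orbit A \<phi> v) = 1} = {?z}"
    using zero orbit_card_neq_1 by auto
  then show "card (orbits_of_size 1) = 1"
    using card_orbits_of_size[of 1] by simp
  have eq: "{v \<in> F2_space 7. card (orbit A \<phi> v) = p} = Fix p - {?z}" if "prime p" for p
    using that Fix_nonzero_orbit zero by (auto simp: Fix_iff)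
  have "card (Fix p) - 1 = card (orbits_of_size p) * p" if "prime p" for p
    using card_orbits_of_size[of p] eq[OF that] zero_in_Fix fin by (simp add: card_Diff_subset)
  from this[of 3] this[of 7] show "card (orbits_of_size 3) = 5" "card (orbits_of_size 7) = 1"
    using card_Fix_3 card_Fix_7 by auto
  have "{v \<in> F2_space 7. card (orbit A \<phi> v) = 21} = F2_space 7 - (Fix 3 \<union> Fix 7)"
    using orbit_card_cases by (force simp: Fix_iff)
  moreover have "card (Fix 3 \<union> Fix 7) = 23"
    using card_Un_Int[OF fin[of 3] fin[of 7]] card_Fix_3 card_Fix_7 Fix_3_Int_Fix_7 by simp
  moreover have "Fix 3 \<union> Fix 7 \<subseteq> F2_space 7" by (auto simp: Fix_def)
  ultimately have "card {v \<in> F2_space 7. card (orbit A \<phi> v) = 21} = 105"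
    using fin by (simp add: card_Diff_subset card_F2_space)
  then show "card (orbits_of_size 21) = 5"
    using card_orbits_of_size[of 21] by simp
qed

lemma orbits_eq:
  "orbits A (F2_space 7) \<phi> =
     orbits_of_size 1 \<union> orbits_of_size 3 \<union> orbits_of_size 7 \<union> orbits_of_size 21"
  using orbit_card_cases by (fastforce simp: orbits_of_size_def orbits_def)

section \<open>Collections of orbits with total size 64\<close>

text \<open>For a set S of orbits this quadruple determines the multiset of sizes, so a condition on
  the sum becomes a linear equation in four small numbers.\<close>

abbreviation multiplicities :: "bit vec set set \<Rightarrow> nat \<times> nat \<times> nat \<times> nat" where
  "multiplicities S \<equiv> (card (S \<inter> orbits_of_size 1), card (S \<inter> orbits_of_size 3),
     card (S \<inter> orbits_of_size 7), card (S \<inter> orbits_of_size 21))"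

lemma sizes_of_collection:
  assumes "S \<subseteq> orbits A (F2_space 7) \<phi>" "multiplicities S = (a, b, c, d)"
  shows "image_mset card (mset_set S) =
    replicate_mset a 1 + replicate_mset b 3 + replicate_mset c 7 + replicate_mset d 21"
proof (rule multiset_eqI)
  fix k
  have fin: "finite S" using assms(1) finite_orbits finite_subset by blast
  have "count (image_mset card (mset_set S)) k = card {X \<in> S. card X = k}"
    using fin by (simp add: count_image_mset_eq_card_vimage)
  also have "{X \<in> S. card X = k} = S \<inter> orbits_of_size k"
    using assms(1) by (auto simp: orbits_of_size_def)
  also have "card \<dots> = count (replicate_mset a 1 + replicate_mset b 3 + replicate_mset c 7 + replicate_mset d 21) k"
  proof (cases "k \<in> {1, 3, 7, 21}")
    case False
    with assms(1) have "S \<inter> orbits_of_size k = {}"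
      using orbit_card_cases by (auto simp: orbits_of_size_def orbits_def)
    with False show ?thesis by simp
  qed (use assms(2) in auto)
  finally show "count (image_mset card (mset_set S)) k =
    count (replicate_mset a 1 + replicate_mset b 3 + replicate_mset c 7 + replicate_mset d 21) k" .
qed

lemma multiplicities_le:
  assumes "multiplicities S = (a, b, c, d)"
  shows "a \<le> 1" "b \<le> 5" "c \<le> 1" "d \<le> 5"
proof -
  have "card (S \<inter> orbits_of_size k) \<le> card (orbits_of_size k)" for k
    by (intro card_mono finite_orbits_of_size) auto
  from this[of 1] this[of 3] this[of 7] this[of 21] show "a \<le> 1" "b \<le> 5" "c \<le> 1" "d \<le> 5"
    using assms card_orbits_of_size_21 by auto
qed

lemma orbit_sizes_21: "orbit_sizes A 7 \<phi> = {#1, 3,3,3,3,3, 7, 21,21,21,21,21#}"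
proof -
  have "orbits A (F2_space 7) \<phi> \<inter> orbits_of_size k = orbits_of_size k" for k
    by (auto simp: orbits_of_size_def)
  then have "multiplicities (orbits A (F2_space 7) \<phi>) = (1, 5, 1, 5)"
    using card_orbits_of_size_21 by simp
  from sizes_of_collection[OF order_refl this] show ?thesis
    by (simp add: orbit_sizes_def numeral_eq_Suc)
qed

lemma sum_64_iff:
  assumes S: "S \<subseteq> orbits A (F2_space 7) \<phi>"
  shows "(\<Sum>X\<in>S. card X) = 64 \<longleftrightarrow> multiplicities S \<in> {(1, 0, 0, 3), (0, 5, 1, 2)}"
proof -
  obtain a b c d where m: "multiplicities S = (a, b, c, d)" by blast
  have "(\<Sum>X\<in>S. card X) = a + b * 3 + c * 7 + d * 21"
    unfolding sum_unfold_sum_mset sizes_of_collection[OF S m] by simp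
  moreover have "a + b * 3 + c * 7 + d * 21 = 64 \<longleftrightarrow> (a, b, c, d) \<in> {(1, 0, 0, 3), (0, 5, 1, 2)}"
  proof
    assume eq: "a + b * 3 + c * 7 + d * 21 = 64"
    note le = multiplicities_le[OF m]
    \<comment> \<open>The orbits of sizes 1, 3 and 7 contribute at most 1 + 15 + 7 = 23, so d is at
      least 2; and 4 * 21 exceeds 64.\<close>
    have "d = 2 \<or> d = 3" using eq le by linarith
    then show "(a, b, c, d) \<in> {(1, 0, 0, 3), (0, 5, 1, 2)}"
    proof
      assume d: "d = 2"
      \<comment> \<open>The remainder 22 is out of reach with b at most 4, since 1 + 12 + 7 =
        20.\<close>
      then have b: "b = 5" using eq le by linarith
      then have "c = 1" using eq d le by linarith
      with eq b d show ?thesis by simp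
    next
      assume d: "d = 3"
      then have "b = 0" "c = 0" using eq by linarith+
      with eq d show ?thesis by simp
    qed
  qed auto
  ultimately show ?thesis using m by simp
qed

lemma sum_64_iff_sizes:
  assumes S: "S \<subseteq> orbits A (F2_space 7) \<phi>"
  shows "(\<Sum>X\<in>S. card X) = 64 \<longleftrightarrow>
    image_mset card (mset_set S) \<in> {{#1, 21,21,21#}, {#3,3,3,3,3, 7, 21,21#}}"
proof
  assume "(\<Sum>X\<in>S. card X) = 64"
  then consider "multiplicities S = (1, 0, 0, 3)" | "multiplicities S = (0, 5, 1, 2)"
    using sum_64_iff[OF S] by blast
  then show "image_mset card (mset_set S) \<in> {{#1, 21,21,21#}, {#3,3,3,3,3, 7, 21,21#}}"
    by cases (simp_all add: sizes_of_collection[OF S] numeral_eq_Suc)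
qed (auto simp: sum_unfold_sum_mset)

text \<open>In each of the two forms the orbits of sizes 1, 3 and 7 are prescribed, and only a
  choice of 3 or of 2 among the five orbits of size 21 is left: 10 + 10 collections.\<close>

lemma card_sum_64:
  "card {S. S \<subseteq> orbits A (F2_space 7) \<phi> \<and> (\<Sum>X\<in>S. card X) = 64} = 20"
proof -
  let ?O = orbits_of_size
  let ?f = "\<lambda>B. ?O 1 \<union> B" and ?g = "\<lambda>B. ?O 3 \<union> ?O 7 \<union> B"
  let ?B = "\<lambda>k. {B. B \<subseteq> ?O 21 \<and> card B = k}"
  have disj: "?O k \<inter> ?O l = {}" if "k \<noteq> l" for k l
    using that by (auto simp: orbits_of_size_def)
  have sub: "?O k \<subseteq> orbits A (F2_space 7) \<phi>" for k
    by (auto simp: orbits_of_size_def)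
  note fin = finite_orbits_of_size
  have full: "S \<inter> ?O k = ?O k \<longleftrightarrow> card (S \<inter> ?O k) = card (?O k)" for S k
    using card_subset_eq[OF fin, of "S \<inter> ?O k" k] by auto
  have empty: "S \<inter> ?O k = {} \<longleftrightarrow> card (S \<inter> ?O k) = 0" for S k
    using fin by simp
  have split: "S = (S \<inter> ?O 1) \<union> (S \<inter> ?O 3) \<union> (S \<inter> ?O 7) \<union> (S \<inter> ?O 21)"
    if "S \<subseteq> orbits A (F2_space 7) \<phi>" for S
    using that orbits_eq by blast
  have collections_eq:
    "{S. S \<subseteq> orbits A (F2_space 7) \<phi> \<and> (\<Sum>X\<in>S. card X) = 64} = ?f ` ?B 3 \<union> ?g ` ?B 2"
  proof (intro equalityI subsetI)
    fix S assume "S \<in> {S. S \<subseteq> orbits A (F2_space 7) \<phi> \<and> (\<Sum>X\<in>S. card X) = 64}"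
    then have S: "S \<subseteq> orbits A (F2_space 7) \<phi>"
      and "multiplicities S = (1, 0, 0, 3) \<or> multiplicities S = (0, 5, 1, 2)"
      using sum_64_iff by auto
    then consider "S \<inter> ?O 1 = ?O 1" "S \<inter> ?O 3 = {}" "S \<inter> ?O 7 = {}" "card (S \<inter> ?O 21) = 3"
      | "S \<inter> ?O 1 = {}" "S \<inter> ?O 3 = ?O 3" "S \<inter> ?O 7 = ?O 7" "card (S \<inter> ?O 21) = 2"
      unfolding full empty using card_orbits_of_size_21 by auto
    then show "S \<in> ?f ` ?B 3 \<union> ?g ` ?B 2"
    proof cases
      case 1
      with split[OF S] have "S = ?f (S \<inter> ?O 21)" by simp
      with 1 show ?thesis by blast
    next
      case 2
      with split[OF S] have "S = ?g (S \<inter> ?O 21)" by simp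
      with 2 show ?thesis by blast
    qed
  next
    fix S assume "S \<in> ?f ` ?B 3 \<union> ?g ` ?B 2"
    then consider B where "S = ?f B" "B \<subseteq> ?O 21" "card B = 3"
      | B where "S = ?g B" "B \<subseteq> ?O 21" "card B = 2" by blast
    then show "S \<in> {S. S \<subseteq> orbits A (F2_space 7) \<phi> \<and> (\<Sum>X\<in>S. card X) = 64}"
    proof cases
      case 1
      then have "S \<inter> ?O 1 = ?O 1" "S \<inter> ?O 3 = {}" "S \<inter> ?O 7 = {}" "S \<inter> ?O 21 = B"
        using disj[of 1 3] disj[of 1 7] disj[of 1 21] disj[of 3 21] disj[of 7 21] by auto
      then have "multiplicities S = (1, 0, 0, 3)"
        using 1 card_orbits_of_size_21 by simp
      moreover have "S \<subseteq> orbits A (F2_space 7) \<phi>" using 1 sub by blast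
      ultimately show ?thesis using sum_64_iff by simp
    next
      case 2
      then have "S \<inter> ?O 1 = {}" "S \<inter> ?O 3 = ?O 3" "S \<inter> ?O 7 = ?O 7" "S \<inter> ?O 21 = B"
        using disj[of 1 3] disj[of 1 7] disj[of 1 21] disj[of 3 21] disj[of 7 21] by auto
      then have "multiplicities S = (0, 5, 1, 2)"
        using 2 card_orbits_of_size_21 by simp
      moreover have "S \<subseteq> orbits A (F2_space 7) \<phi>" using 2 sub by blast
      ultimately show ?thesis using sum_64_iff by simp
    qed
  qed
  have "card (?f ` ?B 3 \<union> ?g ` ?B 2) = card (?f ` ?B 3) + card (?g ` ?B 2)"
  proof (rule card_Un_disjoint)
    \<comment> \<open>The orbit of size 1 belongs to every member of the first family and to none of
      the second.\<close>
    obtain X where X: "X \<in> ?O 1"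
      using card_orbits_of_size_21(1) by (metis card.empty equals0I zero_neq_one)
    then have "X \<notin> S" if "S \<in> ?g ` ?B 2" for S
      using disj[of 1 3] disj[of 1 7] disj[of 1 21] that by auto
    moreover have "X \<in> S" if "S \<in> ?f ` ?B 3" for S
      using X that by auto
    ultimately show "?f ` ?B 3 \<inter> ?g ` ?B 2 = {}"
      by (meson disjoint_iff)
    show "finite (?f ` ?B 3)" "finite (?g ` ?B 2)"
      by (intro finite_imageI finite_subset[OF _ finite_Pow_iff[THEN iffD2, OF fin[of 21]]]; blast)+
  qed
  \<comment> \<open>Intersecting with the orbits of size 21 recovers the chosen subset, here and for
    \<open>?g\<close>.\<close>
  moreover have "card (?f ` ?B 3) = card (?B 3)"
  proof (intro card_image inj_on_inverseI[where g = "\<lambda>S. S \<inter> ?O 21"])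
    have "?O 1 \<inter> ?O 21 = {}" by (rule disj) simp
    then show "?f B \<inter> ?O 21 = B" if "B \<in> ?B 3" for B
      using that by blast
  qed
  moreover have "card (?g ` ?B 2) = card (?B 2)"
  proof (intro card_image inj_on_inverseI[where g = "\<lambda>S. S \<inter> ?O 21"])
    have "?O 3 \<inter> ?O 21 = {}" "?O 7 \<inter> ?O 21 = {}" by (rule disj, simp)+
    then show "?g B \<inter> ?O 21 = B" if "B \<in> ?B 2" for B
      using that by blast
  qed
  moreover have "card (?B 3) + card (?B 2) = 20"
    unfolding n_subsets[OF fin] card_orbits_of_size_21(4) by (simp add: numeral_eq_Suc)
  ultimately show ?thesis
    unfolding collections_eq by linarith
qed

end

section \<open>Transitive submodules and the decomposition\<close>

lemma exists_outside:
  assumes "finite U" "card U < card W"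
  obtains w where "w \<in> W" "w \<notin> U"
  using assms card_mono[of U W] by (metis not_le subsetI)

text \<open>Addition being its own inverse, the equation gives \<open>u + u' = w + w'\<close>, a
  vector in both subspaces and hence 0.\<close>

lemma F2_subspace_direct:
  assumes "F2_subspace n U" "F2_subspace n W" "U \<inter> W = {0\<^sub>v n}"
    and "u \<in> U" "u' \<in> U" "w \<in> W" "w' \<in> W" "u + w = u' + w'"
  shows "u = u' \<and> w = w'"
proof -
  have mem: "u \<in> F2_space n" "u' \<in> F2_space n" "w \<in> F2_space n" "w' \<in> F2_space n"
    using assms by (auto simp: F2_subspace_def)
  have "(u + u') + (w + w') = (u + w) + (u' + w')"
    using mem by (intro eq_vecI) auto
  also have "\<dots> = 0\<^sub>v n"
    by (simp only: assms(8) F2_vec_add_self add_carrier_vec mem)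
  finally have eq: "u + u' = w + w'"
    using mem F2_add_eq_zero_iff[of "u + u'" n "w + w'"] by simp
  have "u + u' \<in> U" "w + w' \<in> W"
    using assms by (auto simp: F2_subspace_def)
  then have "u + u' = 0\<^sub>v n" "w + w' = 0\<^sub>v n"
    using assms(3) eq by auto
  then show ?thesis
    using mem F2_add_eq_zero_iff by blast
qed

context cyclic_odd_action
begin

lemma submodule_iff: "submodule_of_action A n \<phi> U \<longleftrightarrow> F2_subspace n U \<and> invariant U"
proof -
  have "c \<cdot>\<^sub>v u \<in> U" if "F2_subspace n U" "u \<in> U" for c u
  proof (cases "c = 0")
    case True
    then have "c \<cdot>\<^sub>v u = 0\<^sub>v n"
      using that by (intro eq_vecI) (auto simp: F2_subspace_def)
    then show ?thesis using that by (simp add: F2_subspace_def)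
  next
    case False
    then have "c \<cdot>\<^sub>v u = u" by (intro eq_vecI) (auto simp: bit_not_zero_iff)
    then show ?thesis using that by simp
  qed
  then show ?thesis
    by (auto simp: submodule_of_action_def F2_subspace_def invariant_def)
qed

text \<open>A nonzero submodule inside U contains a nonzero vector, and the orbit of that vector is
  all of U except 0.\<close>

lemma transitive_irreducible:
  assumes "submodule_of_action A n \<phi> U" "v \<in> U" "orbit A \<phi> v = U - {0\<^sub>v n}"
  shows "irreducible_submodule A n \<phi> U"
  unfolding irreducible_submodule_def
proof (intro conjI allI impI assms(1))
  have U: "U \<subseteq> F2_space n" "0\<^sub>v n \<in> U" and v: "v \<in> F2_space n"
    using assms(1,2) by (auto simp: submodule_of_action_def)
  have v_orbit: "v \<in> orbit A \<phi> v" by (rule orbit_refl[OF v])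
  then show "U \<noteq> {0\<^sub>v n}" using assms(3) by auto
  fix W assume W: "submodule_of_action A n \<phi> W \<and> W \<subseteq> U"
  show "W = {0\<^sub>v n} \<or> W = U"
  proof (cases "W = {0\<^sub>v n}")
    case False
    moreover have "0\<^sub>v n \<in> W" using W by (simp add: submodule_of_action_def)
    ultimately obtain w where w: "w \<in> W" "w \<noteq> 0\<^sub>v n" by blast
    then have w': "w \<in> F2_space n" "w \<in> orbit A \<phi> v" using W U assms(3) by auto
    have "u \<in> W" if "u \<in> U" "u \<noteq> 0\<^sub>v n" for u
    proof -
      have "u \<in> orbit A \<phi> w"
        using orbit_trans[OF w'(1) v, of u] orbit_sym[OF v w'(1,2)] that U assms(3) by blast
      then show ?thesis
        using W w by (auto simp: orbit_def submodule_of_action_def)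
    qed
    with \<open>0\<^sub>v n \<in> W\<close> W show ?thesis by blast
  qed simp
qed

text \<open>
  The vectors of a transitive submodule are, apart from 0, of the form \<open>\<phi> a v\<close>; letting such a
  vector multiply as \<open>\<phi> a\<close> turns the submodule into a field with unit \<open>v\<close>.
\<close>

lemma transitive_iso_to_GF:
  assumes sub: "submodule_of_action A n \<phi> U" and v: "v \<in> U"
    and trans: "orbit A \<phi> v = U - {0\<^sub>v n}"
  shows "iso_to_GF (card U) A \<phi> U"
proof -
  let ?z = "0\<^sub>v n :: bit vec"
  have subspace: "F2_subspace n U" and inv: "invariant U"
    using sub submodule_iff by auto
  have U: "u \<in> U \<Longrightarrow> u \<in> F2_space n" for u
    using subspace by (auto simp: F2_subspace_def)
  have add: "u \<in> U \<Longrightarrow> w \<in> U \<Longrightarrow> u + w \<in> U" and zero: "?z \<in> U" for u w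
    using subspace by (auto simp: F2_subspace_def)
  have act: "a \<in> carrier A \<Longrightarrow> u \<in> U \<Longrightarrow> \<phi> a u \<in> U" for a u
    using inv by (auto simp: invariant_def)
  have nonzero: "\<phi> a v \<noteq> ?z" if "a \<in> carrier A" for a
    using that trans by (auto simp: orbit_def)
  have rep: "\<exists>a \<in> carrier A. u = \<phi> a v" if "u \<in> U" "u \<noteq> ?z" for u
    using that trans by (auto simp: orbit_def)
  define s where "s u = (SOME a. a \<in> carrier A \<and> \<phi> a v = u)" for u
  define m where "m u w = (if u = ?z then ?z else \<phi> (s u) w)" for u w
  have m_zero: "m ?z w = ?z" for w
    by (simp add: m_def)
  \<comment> \<open>The element chosen by \<open>s\<close> need not be a itself, but both send v to
    the same vector. Since A is commutative and w is 0 or an image of v, they also agree on w, so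
    the product does not depend on the choice.\<close>
  have m_act: "m (\<phi> a v) w = \<phi> a w" if aw: "a \<in> carrier A" "w \<in> U" for a w
  proof -
    have s: "s (\<phi> a v) \<in> carrier A \<and> \<phi> (s (\<phi> a v)) v = \<phi> a v"
      unfolding s_def by (rule someI[of _ a]) (use that in simp)
    show ?thesis
    proof (cases "w = ?z")
      case True
      then show ?thesis using s that by (simp add: m_def action_zero)
    next
      case False
      obtain b where b: "b \<in> carrier A" "w = \<phi> b v" using rep[OF aw(2) False] by blast
      have "\<phi> (s (\<phi> a v)) w = \<phi> b (\<phi> (s (\<phi> a v)) v)"
        unfolding b(2) using s b(1) U[OF v] by (intro action_comm) auto
      also have "\<dots> = \<phi> b (\<phi> a v)"
        using s by simp
      also have "\<dots> = \<phi> a w"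
        unfolding b(2) using b(1) that(1) U[OF v] by (intro action_comm)
      finally show ?thesis using nonzero that by (simp add: m_def)
    qed
  qed
  have m_closed: "m u w \<in> U" if "u \<in> U" "w \<in> U" for u w
    using that rep[of u] m_act act zero m_zero by (cases "u = ?z") auto
  have m_right_zero: "m u ?z = ?z" if "u \<in> U" for u
    using that rep[of u] m_act zero m_zero action_zero by (cases "u = ?z") auto
  have m_comm: "m u w = m w u" if uw: "u \<in> U" "w \<in> U" for u w
  proof (cases "u = ?z \<or> w = ?z")
    case True
    with uw show ?thesis using m_zero m_right_zero by auto
  next
    case False
    then obtain a b where ab: "a \<in> carrier A" "b \<in> carrier A" "u = \<phi> a v" "w = \<phi> b v"
      using rep[of u] rep[of w] uw by blast
    then have "m u w = \<phi> a (\<phi> b v)" "m w u = \<phi> b (\<phi> a v)"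
      using m_act uw by auto
    then show ?thesis
      using action_comm[OF ab(1,2) U[OF v]] by simp
  qed
  have m_assoc: "m (m u w) x = m u (m w x)" if uwx: "u \<in> U" "w \<in> U" "x \<in> U" for u w x
  proof (cases "u = ?z \<or> w = ?z")
    case True
    with uwx show ?thesis using m_zero m_right_zero by auto
  next
    case False
    then obtain a b where ab: "a \<in> carrier A" "b \<in> carrier A" "u = \<phi> a v" "w = \<phi> b v"
      using rep[of u] rep[of w] uwx by blast
    have "m u w = \<phi> (a \<otimes> b) v"
      using m_act[OF ab(1) uwx(2)] composition_rule[OF U[OF v] ab(1,2)] ab(3,4) by simp
    then have "m (m u w) x = \<phi> (a \<otimes> b) x"
      using m_act[of "a \<otimes> b" x] ab(1,2) uwx(3) by simp
    also have "\<dots> = \<phi> a (\<phi> b x)"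
      by (rule composition_rule[OF U[OF uwx(3)] ab(1,2)])
    also have "\<dots> = m u (m w x)"
      using m_act ab uwx act by simp
    finally show ?thesis .
  qed
  have m_distr: "m u (w + x) = m u w + m u x" if uwx: "u \<in> U" "w \<in> U" "x \<in> U" for u w x
  proof (cases "u = ?z")
    case True
    with uwx show ?thesis using m_zero by simp
  next
    case False
    obtain a where a: "a \<in> carrier A" "u = \<phi> a v" using rep[OF uwx(1) False] by blast
    with uwx show ?thesis using m_act[OF a(1)] add action_add[OF _ U U] by simp
  qed
  have one: "m v w = w" if "w \<in> U" for w
    using m_act[of \<one> w] that U v action_one by simp
  define R where "R = \<lparr>carrier = U, mult = m, one = v, zero = ?z, add = (+)\<rparr>"
  have "cring R"
  proof (rule cringI)
    show "abelian_group R"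
    proof (rule abelian_groupI)
      show "\<exists>y \<in> carrier R. y \<oplus>\<^bsub>R\<^esub> x = \<zero>\<^bsub>R\<^esub>" if "x \<in> carrier R" for x
        using that U F2_vec_add_self by (auto simp: R_def intro!: bexI[of _ x])
    qed (use add zero U in \<open>auto simp: R_def intro!: assoc_add_vec comm_add_vec\<close>)
    show "comm_monoid R"
      by (rule comm_monoidI) (use m_closed v m_assoc one m_comm in \<open>auto simp: R_def\<close>)
    show "(x \<oplus>\<^bsub>R\<^esub> y) \<otimes>\<^bsub>R\<^esub> z = x \<otimes>\<^bsub>R\<^esub> z \<oplus>\<^bsub>R\<^esub> y \<otimes>\<^bsub>R\<^esub> z"
      if "x \<in> carrier R" "y \<in> carrier R" "z \<in> carrier R" for x y z
      using that m_distr[of z x y] m_comm[of z] add by (simp add: R_def)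
  qed
  then interpret R: cring R .
  have "field R"
  proof (rule R.cring_fieldI2)
    show "\<zero>\<^bsub>R\<^esub> \<noteq> \<one>\<^bsub>R\<^esub>"
      using nonzero[of \<one>] U v action_one by (auto simp: R_def)
    fix x assume "x \<in> carrier R" "x \<noteq> \<zero>\<^bsub>R\<^esub>"
    then obtain a where a: "a \<in> carrier A" "x = \<phi> a v" using rep by (auto simp: R_def)
    then have "m x (\<phi> (inv a) v) = \<phi> (a \<otimes> inv a) v"
      using m_act[OF a(1), of "\<phi> (inv a) v"] act v composition_rule[OF U[OF v], of a "inv a"] by simp
    also have "\<dots> = v" using a(1) U[OF v] action_one by simp
    finally have "m x (\<phi> (inv a) v) = v" .
    then show "\<exists>b \<in> carrier R. x \<otimes>\<^bsub>R\<^esub> b = \<one>\<^bsub>R\<^esub>"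
      using a act v by (auto simp: R_def)
  qed
  then interpret R: field R .
  \<comment> \<open>\<open>iso_to_GF\<close> asks for a field on natural numbers, so the structure
    is carried over along a numbering h of U.\<close>
  obtain h :: "bit vec \<Rightarrow> nat" where h: "bij_betw h U {0..<card U}"
    using ex_bij_betw_finite_nat[OF invariant_finite[OF inv]] by blast
  then have inj: "inj_on h (carrier R)" by (simp add: bij_betw_def R_def)
  let ?K = "image_ring h R"
  have iso: "h \<in> ring_iso R ?K"
    by (rule inj_imp_image_ring_iso[OF inj])
  then have hom: "h \<in> ring_hom R ?K" by (simp add: ring_iso_def)
  show ?thesis
    unfolding iso_to_GF_def
  proof (intro exI conjI ballI)
    show "field ?K" by (rule R.inj_imp_image_ring_is_field[OF inj])
    show "bij_betw h U (carrier ?K)"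
      using iso by (simp add: ring_iso_def R_def)
    then show "order ?K = card U"
      by (simp add: order_def bij_betw_same_card)
    show "h (u + w) = h u \<oplus>\<^bsub>?K\<^esub> h w" if "u \<in> U" "w \<in> U" for u w
      using ring_hom_add[OF hom, of u w] that by (simp add: R_def)
    \<comment> \<open>The scalar is the image of \<open>\<phi> a v\<close>, since multiplication by
      \<open>\<phi> a v\<close> is \<open>\<phi> a\<close>.\<close>
    show "\<exists>c \<in> carrier ?K. \<forall>u \<in> U. h (\<phi> a u) = c \<otimes>\<^bsub>?K\<^esub> h u" if a: "a \<in> carrier A" for a
    proof (intro bexI ballI)
      show "h (\<phi> a v) \<in> carrier ?K"
        using a act v by (simp add: image_ring_carrier R_def)
      show "h (\<phi> a u) = h (\<phi> a v) \<otimes>\<^bsub>?K\<^esub> h u" if "u \<in> U" for u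
        using ring_hom_mult[OF hom, of "\<phi> a v" u] that a act v m_act by (simp add: R_def)
    qed
  qed
qed

text \<open>The p-th power of \<open>\<phi> g\<close> is trivial on U because U lies in
  \<open>Fix p\<close>, so the order is 1 or p. It is not 1, because g fixes no nonzero
  vector.\<close>

lemma order_on_prime:
  assumes "prime p" "invariant U" "U \<subseteq> Fix p" "u \<in> U" "u \<noteq> 0\<^sub>v n"
  shows "order_on \<phi> g U = p"
proof -
  interpret B: group "BijGroup U" by (rule group_BijGroup)
  let ?x = "restrict (\<phi> g) U"
  have U: "w \<in> U \<Longrightarrow> w \<in> F2_space n" for w using assms(2) by (auto simp: invariant_def)
  have act: "a \<in> carrier A \<Longrightarrow> w \<in> U \<Longrightarrow> \<phi> a w \<in> U" for a w
    using assms(2) by (auto simp: invariant_def)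
  have "inj_on (\<phi> g) U"
    using inj_prop[OF g_closed] U by (meson inj_on_subset subsetI)
  moreover have "\<phi> g ` U \<subseteq> U" using act g_closed by auto
  ultimately have "bij_betw (\<phi> g) U U"
    using endo_inj_surj[OF invariant_finite[OF assms(2)]] by (simp add: bij_betw_def)
  then have x: "?x \<in> carrier (BijGroup U)"
    by (simp add: BijGroup_def Bij_def bij_betw_restrict_eq)
  have mult: "x \<otimes>\<^bsub>BijGroup U\<^esub> y = compose U x y"
    if "x \<in> carrier (BijGroup U)" "y \<in> carrier (BijGroup U)" for x y
    using that by (simp add: BijGroup_def)
  have pow: "?x [^]\<^bsub>BijGroup U\<^esub> k = restrict (\<phi> (g [^] k)) U" for k :: nat
  proof (induction k)
    case 0
    show ?case using action_one U by (auto simp: BijGroup_def)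
  next
    case (Suc k)
    have "?x [^]\<^bsub>BijGroup U\<^esub> Suc k = ?x [^]\<^bsub>BijGroup U\<^esub> k \<otimes>\<^bsub>BijGroup U\<^esub> ?x"
      by (rule B.nat_pow_Suc)
    also have "\<dots> = compose U (?x [^]\<^bsub>BijGroup U\<^esub> k) ?x"
      by (rule mult[OF B.nat_pow_closed[OF x] x])
    also have "\<dots> = compose U (restrict (\<phi> (g [^] k)) U) ?x"
      by (simp only: Suc)
    also have "\<dots> = restrict (\<phi> (g [^] Suc k)) U"
      using act[OF g_closed] U g_closed composition_rule by (simp add: compose_def restrict_def fun_eq_iff)
    finally show ?case .
  qed
  have "?x [^]\<^bsub>BijGroup U\<^esub> p = \<one>\<^bsub>BijGroup U\<^esub>"
    unfolding pow using assms(3) by (auto simp: BijGroup_def Fix_def restrict_def fun_eq_iff)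
  then have "B.ord ?x dvd p"
    using B.pow_eq_id[OF x] by simp
  moreover have "B.ord ?x \<noteq> 1"
  proof
    assume "B.ord ?x = 1"
    then have "?x = \<one>\<^bsub>BijGroup U\<^esub>"
      using B.ord_eq_1[OF x] by simp
    then have "?x u = u" using assms(4) by (simp add: BijGroup_def)
    then have "u \<in> Fix 1" using assms(4) U g_closed by (simp add: Fix_def)
    then show False
      using assms(4,5) U orbit_card_neq_1 by (auto simp: Fix_iff)
  qed
  ultimately show ?thesis
    using assms(1) by (auto simp: order_on_def prime_nat_iff)
qed

section \<open>The three summands and their direct sum\<close>

text \<open>The sum of v, its image a and the second image b is fixed by g, hence 0. So b = v + a,
  and the orbit together with 0 is the space spanned by v and a.\<close>

lemma Fix_3_orbit_subspace:
  assumes v: "v \<in> Fix 3" "v \<noteq> 0\<^sub>v n"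
  shows "submodule_of_action A n \<phi> (insert (0\<^sub>v n) (orbit A \<phi> v))"
    and "card (orbit A \<phi> v) = 3"
proof -
  let ?z = "0\<^sub>v n :: bit vec"
  have vV: "v \<in> F2_space n" using v by (simp add: Fix_def)
  have "card (orbit A \<phi> v) dvd 3" using v by (simp add: Fix_iff)
  moreover have "prime (3 :: nat)" by simp
  ultimately show card: "card (orbit A \<phi> v) = 3"
    using orbit_card_neq_1[OF vV v(2)] by (auto simp: prime_nat_iff)
  define a where "a = \<phi> g v"
  define b where "b = \<phi> g a"
  have mem: "a \<in> F2_space n" "b \<in> F2_space n"
    using vV g_closed action_closed by (simp_all add: a_def b_def)
  have gb: "\<phi> g b = v"
    using v g_closed vV action_closed composition_rule
    by (simp add: Fix_def a_def b_def numeral_3_eq_3 m_assoc)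
  have "\<phi> g (v + a + b) = a + b + v"
    using vV mem g_closed gb by (simp add: action_add flip: a_def b_def)
  also have "\<dots> = v + a + b"
    using vV mem by (intro eq_vecI) auto
  finally have "v + a + b \<in> Fix 1"
    using vV mem g_closed by (simp add: Fix_def)
  then have "v + a + b = ?z"
    using orbit_card_neq_1 by (auto simp: Fix_iff)
  then have b_eq: "b = v + a"
    using F2_add_eq_zero_iff[of "v + a" n b] vV mem by simp
  let ?S = "{?z, v, a, v + a}"
  have S_sub: "F2_subspace n ?S"
  proof -
    have "v + (v + a) = a" "a + (v + a) = v" "a + v = v + a" "v + a + v = a" "v + a + a = v"
      using vV mem by (auto intro!: eq_vecI)
    then show ?thesis
      using vV mem by (auto simp: F2_subspace_def F2_vec_add_self)
  qed
  have g_S: "\<phi> g u \<in> ?S" if "u \<in> ?S" for u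
    using that gb b_eq action_zero[OF g_closed] by (auto simp flip: a_def b_def)
  have pow_S: "\<phi> (g [^] (k :: nat)) u \<in> ?S" if "u \<in> ?S" for k u
  proof (induction k)
    case 0
    have "u \<in> F2_space n" using that S_sub unfolding F2_subspace_def by blast
    then show ?case using action_one that by simp
  next
    case (Suc k)
    have "u \<in> F2_space n" using that S_sub unfolding F2_subspace_def by blast
    then have "\<phi> (g [^] Suc k) u = \<phi> g (\<phi> (g [^] k) u)"
      using composition_rule g_closed nat_pow_Suc2 by simp
    then show ?case using g_S Suc by simp
  qed
  have inv: "invariant ?S"
    unfolding invariant_def
  proof (intro conjI ballI)
    show "?S \<subseteq> F2_space n" using S_sub unfolding F2_subspace_def by blast
    fix c u assume "c \<in> carrier A" and u: "u \<in> ?S"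
    then obtain k :: nat where "c = g [^] k" unfolding carrier_eq by blast
    with pow_S[OF u] show "\<phi> c u \<in> ?S" by simp
  qed
  \<comment> \<open>The orbit has three elements and lies in a set of at most three, which gives
    equality without a check that v, a and v + a are distinct.\<close>
  have "orbit A \<phi> v \<subseteq> ?S - {?z}"
  proof
    fix u assume "u \<in> orbit A \<phi> v"
    then obtain c where c: "c \<in> carrier A" "u = \<phi> c v" by (auto simp: orbit_def)
    then have "u \<in> ?S" using inv unfolding invariant_def by blast
    moreover have "u \<noteq> ?z"
    proof
      assume "u = ?z"
      then have "\<phi> c v = \<phi> c ?z" using c action_zero by simp
      then show False using inj_prop[OF c(1)] vV v(2) by (auto simp: inj_on_def)
    qed
    ultimately show "u \<in> ?S - {?z}" by blast
  qed
  moreover have "card (?S - {?z}) \<le> 3"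
  proof -
    have "card (?S - {?z}) \<le> card {v, a, v + a}" by (intro card_mono) auto
    also have "\<dots> \<le> 3" using card_length[of "[v, a, v + a]"] by simp
    finally show ?thesis .
  qed
  ultimately have "orbit A \<phi> v = ?S - {?z}"
    using card by (intro card_seteq) auto
  then have "insert ?z (orbit A \<phi> v) = ?S" by blast
  then show "submodule_of_action A n \<phi> (insert ?z (orbit A \<phi> v))"
    using S_sub inv submodule_iff by simp
qed

end

context order_21_action
begin

text \<open>Two summands come from two different orbits in \<open>Fix 3\<close>; the third is
  \<open>Fix 7\<close>, whose 7 nonzero vectors form a single orbit. The sum is direct because
  \<open>Fix 3\<close> meets \<open>Fix 7\<close> in 0 and the two orbits are disjoint, and it fills
  the space because 4 * 4 * 8 = 128.\<close>

lemma decomposition: "F4_F4_F8_decomposition A 7 \<phi>"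
proof -
  let ?z = "0\<^sub>v 7 :: bit vec"
  let ?U = "\<lambda>v. insert ?z (orbit A \<phi> v)"
  obtain v1 where v1: "v1 \<in> Fix 3" "v1 \<notin> {?z}"
    by (rule exists_outside[of "{?z}" "Fix 3"]) (auto simp: card_Fix_3)
  obtain v2 where v2: "v2 \<in> Fix 3" "v2 \<notin> ?U v1"
  proof (rule exists_outside)
    have "card (orbit A \<phi> v1) = 3" using Fix_3_orbit_subspace(2) v1 by simp
    moreover from this have "finite (orbit A \<phi> v1)"
      by (intro card_ge_0_finite) simp
    ultimately show "finite (?U v1)" "card (?U v1) < card (Fix 3)"
      by (simp_all add: card_Fix_3 card_insert_if)
  qed
  obtain v3 where v3: "v3 \<in> Fix 7" "v3 \<notin> {?z}"
    by (rule exists_outside[of "{?z}" "Fix 7"]) (auto simp: card_Fix_7)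
  have V: "v1 \<in> F2_space 7" "v2 \<in> F2_space 7" "v3 \<in> F2_space 7"
    using v1 v2 v3 by (auto simp: Fix_def)
  have nonzero: "?z \<notin> orbit A \<phi> v" if "v \<in> F2_space 7" "v \<noteq> ?z" for v
  proof
    assume "?z \<in> orbit A \<phi> v"
    then have "v \<in> orbit A \<phi> ?z" using orbit_sym[OF that(1)] by simp
    then show False using that action_zero by (auto simp: orbit_def)
  qed
  have card3: "card (orbit A \<phi> v) = 3" and card_U: "card (?U v) = 4"
    and sub: "submodule_of_action A 7 \<phi> (?U v)"
    if "v \<in> Fix 3" "v \<noteq> ?z" for v
  proof -
    show c: "card (orbit A \<phi> v) = 3" and "submodule_of_action A 7 \<phi> (?U v)"
      using Fix_3_orbit_subspace[OF that] by simp_all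
    have "finite (orbit A \<phi> v)" using c by (intro card_ge_0_finite) simp
    with c nonzero[of v] that show "card (?U v) = 4" by (auto simp: Fix_def)
  qed
  have U3: "orbit A \<phi> v3 = Fix 7 - {?z}"
  proof (rule card_subset_eq)
    show "finite (Fix 7 - {?z})" using invariant_finite[OF Fix_invariant] by simp
    show "orbit A \<phi> v3 \<subseteq> Fix 7 - {?z}"
      using Fix_invariant[of 7] v3 nonzero[OF V(3)] by (auto simp: orbit_def invariant_def)
    show "card (orbit A \<phi> v3) = card (Fix 7 - {?z})"
      using Fix_nonzero_orbit[of 7 v3] v3 zero_in_Fix by (simp add: card_Diff_subset card_Fix_7)
  qed
  have sub1: "submodule_of_action A 7 \<phi> (?U v1)" and sub2: "submodule_of_action A 7 \<phi> (?U v2)"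
    and sub3: "submodule_of_action A 7 \<phi> (Fix 7)"
    using sub v1 v2 Fix_subspace Fix_invariant submodule_iff by auto
  have U_Fix: "?U v \<subseteq> Fix 3" if "v \<in> Fix 3" for v
    using that Fix_invariant[of 3] zero_in_Fix by (auto simp: orbit_def invariant_def)
  have mem: "v1 \<in> ?U v1" "v2 \<in> ?U v2" using orbit_refl V by auto
  have trans: "orbit A \<phi> v = ?U v - {?z}" if "v \<in> F2_space 7" "v \<noteq> ?z" for v
    using nonzero[OF that] by blast
  have disj: "?U v1 \<inter> ?U v2 = {?z}"
  proof -
    have "orbit A \<phi> v1 \<noteq> orbit A \<phi> v2"
      using v2 orbit_refl[OF V(2)] by auto
    then have "orbit A \<phi> v1 \<inter> orbit A \<phi> v2 = {}"
      using disjoint_union[of "orbit A \<phi> v1" "orbit A \<phi> v2"] V by (auto simp: orbits_def)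
    then show ?thesis using nonzero V v1 v2 by blast
  qed
  have ne: "v1 \<noteq> ?z" "v2 \<noteq> ?z" "v3 \<noteq> ?z" using v1 v2 v3 by auto
  let ?f = "\<lambda>(u1, u2, u3). u1 + u2 + u3 :: bit vec"
  let ?P = "?U v1 \<times> ?U v2 \<times> Fix 7"
  have inj: "inj_on ?f ?P"
  proof (rule inj_onI)
    fix x y assume xy: "x \<in> ?P" "y \<in> ?P" "?f x = ?f y"
    obtain u1 u2 u3 w1 w2 w3 where eqs: "x = (u1, u2, u3)" "y = (w1, w2, w3)"
      by (metis prod_cases3)
    with xy have u: "u1 \<in> ?U v1" "u2 \<in> ?U v2" "u3 \<in> Fix 7"
      and w: "w1 \<in> ?U v1" "w2 \<in> ?U v2" "w3 \<in> Fix 7"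
      by (simp_all only: mem_Sigma_iff)
    from xy(3) eqs have eq: "u1 + u2 + u3 = w1 + w2 + w3" by simp
    have "u1 \<in> Fix 3" "u2 \<in> Fix 3" "w1 \<in> Fix 3" "w2 \<in> Fix 3"
      using u w U_Fix v1(1) v2(1) by blast+
    then have "u1 + u2 \<in> Fix 3" "w1 + w2 \<in> Fix 3"
      using Fix_subspace[of 3] by (auto simp: F2_subspace_def)
    then have "u1 + u2 = w1 + w2" and 3: "u3 = w3"
      using F2_subspace_direct[OF Fix_subspace Fix_subspace Fix_3_Int_Fix_7 _ _ u(3) w(3) eq] by auto
    then have "u1 = w1 \<and> u2 = w2"
      using F2_subspace_direct[of 7 "?U v1" "?U v2" u1 w1 u2 w2] disj sub1 sub2 u w submodule_iff
      by blast
    with 3 eqs show "x = y" by simp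
  qed
  have "?f ` ?P = F2_space 7"
  proof (rule card_subset_eq[OF finite_F2_space])
    have "Fix k \<subseteq> F2_space 7" for k by (auto simp: Fix_def)
    then have "?P \<subseteq> F2_space 7 \<times> F2_space 7 \<times> F2_space 7"
      using U_Fix[OF v1(1)] U_Fix[OF v2(1)] by (intro Sigma_mono) (blast intro: order_trans)+
    moreover have "?f x \<in> F2_space 7" if "x \<in> F2_space 7 \<times> F2_space 7 \<times> F2_space 7" for x
      using that by auto
    ultimately show "?f ` ?P \<subseteq> F2_space 7" by blast
    have "card (?f ` ?P) = card ?P" by (rule card_image[OF inj])
    also have "\<dots> = 128"
      using card_U v1 v2 ne by (simp only: card_cartesian_product card_Fix_7) simp
    finally show "card (?f ` ?P) = card (F2_space 7)" by (simp add: card_F2_space)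
  qed
  with inj have sum: "direct_sum3 (F2_space 7) (?U v1) (?U v2) (Fix 7)"
    by (simp add: direct_sum3_def bij_betw_def)
  have "iso_to_GF 4 A \<phi> (?U v1)" "iso_to_GF 4 A \<phi> (?U v2)" "iso_to_GF 8 A \<phi> (Fix 7)"
    using transitive_iso_to_GF[OF sub1 mem(1) trans[OF V(1) ne(1)]]
      transitive_iso_to_GF[OF sub2 mem(2) trans[OF V(2) ne(2)]]
      transitive_iso_to_GF[OF sub3 v3(1) U3]
    using card_U v1 v2 ne card_Fix_7 by auto
  moreover have "order_on \<phi> g (?U v1) = 3" "order_on \<phi> g (?U v2) = 3" "order_on \<phi> g (Fix 7) = 7"
    using order_on_prime[of 3 "?U v1" v1] order_on_prime[of 3 "?U v2" v2] order_on_prime[of 7 "Fix 7" v3]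
      sub1 sub2 sub3 mem v1(1) v2(1) v3(1) ne U_Fix submodule_iff by auto
  moreover have "irreducible_submodule A 7 \<phi> (?U v1)" "irreducible_submodule A 7 \<phi> (?U v2)"
    "irreducible_submodule A 7 \<phi> (Fix 7)"
    using transitive_irreducible[OF sub1 mem(1) trans[OF V(1) ne(1)]]
      transitive_irreducible[OF sub2 mem(2) trans[OF V(2) ne(2)]]
      transitive_irreducible[OF sub3 v3(1) U3] .
  ultimately show ?thesis
    unfolding F4_F4_F8_decomposition_def using sum g_closed generate_g by blast
qed

end

lemma cyclic_odd_pair_locale:
  assumes "cyclic_odd_pair A n \<phi>"
  obtains g where "cyclic_odd_action A n \<phi> g"
proof -
  obtain g where "g \<in> carrier A" "subgroup_generated A {g} = A"
    using assms by (auto simp: cyclic_odd_pair_def cyclic_group_def)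
  then have "cyclic_odd_action A n \<phi> g"
    using assms by (auto simp: cyclic_odd_pair_def cyclic_odd_action_def cyclic_odd_action_axioms_def)
  then show thesis by (rule that)
qed

section \<open>An action of the cyclic group of order 21\<close>

text \<open>
  The block sum of the companion matrices of \<open>x\<^sup>2 + x + 1\<close> (twice) and \<open>x\<^sup>3 + x + 1\<close>, of
  orders 3 and 7.
\<close>

definition vec7 :: "bit \<Rightarrow> bit \<Rightarrow> bit \<Rightarrow> bit \<Rightarrow> bit \<Rightarrow> bit \<Rightarrow> bit \<Rightarrow> bit vec" where
  "vec7 a b c d e f g = vec 7 (\<lambda>i. [a, b, c, d, e, f, g] ! i)"

lemma vec7_closed [simp]: "vec7 a b c d e f g \<in> F2_space 7"
  by (simp add: vec7_def)

lemma dim_vec7 [simp]: "dim_vec (vec7 a b c d e f g) = 7"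
  by (simp add: vec7_def)

lemma vec7_index [simp]:
  "vec7 a b c d e f g $ 0 = a" "vec7 a b c d e f g $ Suc 0 = b" "vec7 a b c d e f g $ 2 = c"
  "vec7 a b c d e f g $ 3 = d" "vec7 a b c d e f g $ 4 = e" "vec7 a b c d e f g $ 5 = f"
  "vec7 a b c d e f g $ 6 = g"
  by (simp_all add: vec7_def)

lemma vec7_eqI:
  assumes "v \<in> F2_space 7" "w \<in> F2_space 7"
    and "v $ 0 = w $ 0" "v $ 1 = w $ 1" "v $ 2 = w $ 2" "v $ 3 = w $ 3" "v $ 4 = w $ 4"
    "v $ 5 = w $ 5" "v $ 6 = w $ 6"
  shows "v = w"
proof (rule eq_vecI)
  fix i assume "i < dim_vec w"
  then have "i \<in> {0, 1, 2, 3, 4, 5, 6}" using assms(2) by auto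
  then show "v $ i = w $ i" using assms(3-) by auto
qed (use assms(1,2) in simp)

lemma vec7_inject [simp]:
  "vec7 a b c d e f g = vec7 a' b' c' d' e' f' g' \<longleftrightarrow>
     a = a' \<and> b = b' \<and> c = c' \<and> d = d' \<and> e = e' \<and> f = f' \<and> g = g'"
  by (metis vec7_index)

lemma vec7_add:
  "vec7 a b c d e f g + vec7 a' b' c' d' e' f' g' =
     vec7 (a + a') (b + b') (c + c') (d + d') (e + e') (f + f') (g + g')"
  by (rule vec7_eqI) simp_all

lemma vec7_cases:
  assumes "v \<in> F2_space 7"
  obtains a b c d e f g where "v = vec7 a b c d e f g"
proof
  show "v = vec7 (v $ 0) (v $ 1) (v $ 2) (v $ 3) (v $ 4) (v $ 5) (v $ 6)"
    by (rule vec7_eqI) (use assms in simp_all)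
qed

definition companion :: "bit vec \<Rightarrow> bit vec" where
  "companion v = vec7 (v $ 1) (v $ 0 + v $ 1) (v $ 3) (v $ 2 + v $ 3) (v $ 5) (v $ 6) (v $ 4 + v $ 5)"

lemma companion_vec7: "companion (vec7 a b c d e f g) = vec7 b (a + b) d (c + d) f g (e + f)"
  unfolding companion_def by (simp only: vec7_index One_nat_def)

lemma companion_closed: "companion v \<in> F2_space 7"
  by (simp add: companion_def)

lemma companion_add:
  assumes "v \<in> F2_space 7" "w \<in> F2_space 7"
  shows "companion (v + w) = companion v + companion w"
proof -
  obtain a b c d e f g a' b' c' d' e' f' g'
    where vw: "v = vec7 a b c d e f g" "w = vec7 a' b' c' d' e' f' g'"
    using assms by (metis vec7_cases)
  show ?thesis
    unfolding vw vec7_add companion_vec7 vec7_inject by (simp only: ac_simps simp_thms)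
qed

text \<open>The first two blocks have order 3 and 7 is 1 modulo 3, so there the seventh power acts
  as \<open>companion\<close> itself; on the last block, of order 7, it is the identity.\<close>

lemma companion_pow_7:
  "(companion ^^ 7) (vec7 a b c d e f g) = vec7 b (a + b) d (c + d) e f g"
  by (cases a; cases b; cases c; cases d; cases e; cases f; cases g;
      simp add: numeral_eq_Suc companion_vec7)

lemma companion_pow_21:
  assumes "v \<in> F2_space 7"
  shows "(companion ^^ 21) v = v"
proof -
  obtain a b c d e f g where v: "v = vec7 a b c d e f g"
    using vec7_cases[OF assms] .
  have "(companion ^^ (7 + (7 + 7))) v = v"
    unfolding funpow_add comp_def v companion_pow_7 vec7_inject
    by (cases a; cases b; cases c; cases d; simp)
  then show ?thesis by simp
qed

lemma companion_fixed:
  assumes "v \<in> F2_space 7" "companion v = v"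
  shows "v = 0\<^sub>v 7"
proof -
  obtain a b c d e f g where v: "v = vec7 a b c d e f g"
    using vec7_cases[OF assms(1)] .
  have "b = a \<and> a + b = b \<and> d = c \<and> c + d = d \<and> f = e \<and> g = f \<and> e + f = g"
    using assms(2) unfolding v companion_vec7 vec7_inject .
  then have "v = vec7 0 0 0 0 0 0 0"
    unfolding v vec7_inject by (cases a; cases c; cases e; simp)
  also have "\<dots> = 0\<^sub>v 7"
    by (rule vec7_eqI) simp_all
  finally show ?thesis .
qed

text \<open>The vector has a nonzero component in a block of order 3 and in the block of order 7, so
  its period is 21; the twenty smaller powers are evaluated one by one.\<close>

lemma companion_pow_neq:
  assumes "0 < k" "k < 21"
  shows "(companion ^^ k) (vec7 1 0 0 0 1 0 0) \<noteq> vec7 1 0 0 0 1 0 0"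
proof -
  let ?e = "vec7 1 0 0 0 1 0 0"
  have "k \<in> set [1..<21]" using assms by auto
  moreover have "\<forall>k \<in> set [1..<21]. (companion ^^ k) ?e \<noteq> ?e"
    by (simp add: upt_rec numeral_eq_Suc companion_vec7)
  ultimately show ?thesis by blast
qed

section \<open>The action of the integers modulo 21\<close>

text \<open>The elements of \<open>integer_mod_group 21\<close> are the integers from 0 to 20, hence
  \<open>nat\<close>; the restriction makes the maps extensional, as membership in
  \<open>Bij\<close> requires.\<close>

definition companion_action :: "int \<Rightarrow> bit vec \<Rightarrow> bit vec" where
  "companion_action a = restrict (companion ^^ nat a) (F2_space 7)"

lemma companion_pow_closed: "v \<in> F2_space 7 \<Longrightarrow> (companion ^^ k) v \<in> F2_space 7"
  by (induction k) (simp_all add: companion_closed)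

text \<open>Since the power 21 is the identity on the space, \<open>companion ^^ 20\<close> inverts
  \<open>companion\<close> there.\<close>

lemma companion_pow_bij: "bij_betw (companion ^^ k) (F2_space 7) (F2_space 7)"
proof -
  have eq: "(companion ^^ 20) (companion v) = v" "companion ((companion ^^ 20) v) = v"
    if "v \<in> F2_space 7" for v
    using companion_pow_21[OF that] funpow_add[of 1 20 companion]
    by (simp_all add: funpow_swap1)
  have "bij_betw companion (F2_space 7) (F2_space 7)"
    by (rule bij_betwI[where g = "companion ^^ 20"]) (use eq companion_closed companion_pow_closed in auto)
  then show ?thesis by (rule bij_betw_funpow)
qed

text \<open>Exponents may be reduced modulo 21, which gives the homomorphism; different exponents
  below 21 are told apart by the vector \<open>?e\<close> of period 21.\<close>

lemma companion_faithful: "faithful_action (integer_mod_group 21) (F2_space 7) companion_action"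
proof (intro faithful_action.intro group_action.intro faithful_action_axioms.intro)
  let ?A = "integer_mod_group 21"
  have bij: "companion_action a \<in> Bij (F2_space 7)" for a
    using companion_pow_bij by (simp add: Bij_def companion_action_def)
  show "group_hom ?A (BijGroup (F2_space 7)) companion_action"
  proof (intro group_hom.intro group_hom_axioms.intro homI)
    fix a b assume ab: "a \<in> carrier ?A" "b \<in> carrier ?A"
    then have nn: "0 \<le> a" "0 \<le> b" by (simp_all add: carrier_integer_mod_group)
    then have "nat ((a + b) mod 21) = (nat a + nat b) mod 21"
      by (simp add: nat_mod_distrib nat_add_distrib)
    then have "(companion ^^ nat ((a + b) mod 21)) v = (companion ^^ nat a) ((companion ^^ nat b) v)"
      if "v \<in> F2_space 7" for v
      using funpow_mod_eq[where f = companion and n = 21 and m = "nat a + nat b", OF companion_pow_21[OF that]]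
      by (simp add: funpow_add)
    then show "companion_action (a \<otimes>\<^bsub>?A\<^esub> b) =
        companion_action a \<otimes>\<^bsub>BijGroup (F2_space 7)\<^esub> companion_action b"
      using bij companion_pow_closed
      by (auto simp: BijGroup_def companion_action_def compose_def restrict_def fun_eq_iff)
  qed (use bij group_BijGroup in \<open>auto simp: BijGroup_def\<close>)
  let ?e = "vec7 1 0 0 0 1 0 0"
  have e: "?e \<in> F2_space 7" by simp
  show "inj_on companion_action (carrier ?A)"
  proof (rule linorder_inj_onI')
    fix a b :: int assume ab: "a \<in> carrier ?A" "b \<in> carrier ?A" "a < b"
    then have lt: "nat a < nat b" "nat b < 21" by (auto simp: carrier_integer_mod_group)
    show "companion_action a \<noteq> companion_action b"
    proof
      assume "companion_action a = companion_action b"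
      then have "companion_action a ?e = companion_action b ?e" by simp
      then have "(companion ^^ nat a) ?e = (companion ^^ nat b) ?e"
        using e by (simp add: companion_action_def)
      also have "\<dots> = (companion ^^ nat a) ((companion ^^ (nat b - nat a)) ?e)"
        using funpow_add[of "nat a" "nat b - nat a" companion]
        unfolding le_add_diff_inverse[OF less_imp_le[OF lt(1)]] by simp
      finally have "(companion ^^ (nat b - nat a)) ?e = ?e"
        using companion_pow_bij[of "nat a"] e companion_pow_closed[OF e]
        by (auto simp: bij_betw_def inj_on_def)
      moreover have "0 < nat b - nat a" "nat b - nat a < 21"
        using lt by linarith+
      ultimately show False using companion_pow_neq by blast
    qed
  qed
qed

lemma companion_pair: "cyclic_odd_pair (integer_mod_group 21) 7 companion_action"
  unfolding cyclic_odd_pair_def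
proof (intro conjI companion_faithful group_integer_mod_group)
  let ?A = "integer_mod_group 21"
  have one: "1 \<in> carrier ?A" by simp
  have "carrier ?A = range (\<lambda>n::int. 1 [^]\<^bsub>?A\<^esub> n)"
  proof -
    have "a \<in> range (\<lambda>n::int. n mod 21)" if "0 \<le> a" "a < 21" for a :: int
      using that by (intro range_eqI[of _ _ a]) simp
    then show ?thesis by (auto simp: int_pow_integer_mod_group carrier_integer_mod_group)
  qed
  then show "cyclic_group ?A"
    using one group.cyclic_group[OF group_integer_mod_group] by blast
  show "odd (order ?A)"
    by (simp add: order_def carrier_integer_mod_group)
  have add: "(companion ^^ k) (v + w) = (companion ^^ k) v + (companion ^^ k) w"
    if "v \<in> F2_space 7" "w \<in> F2_space 7" for k v w
    using that by (induction k) (simp_all add: companion_add companion_pow_closed)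
  \<comment> \<open>With w the image of 0, additivity gives w + w = w, while w + w = 0.\<close>
  have zero: "(companion ^^ k) (0\<^sub>v 7) = 0\<^sub>v 7" for k
  proof -
    have "(companion ^^ k) (0\<^sub>v 7) + (companion ^^ k) (0\<^sub>v 7) = (companion ^^ k) (0\<^sub>v 7)"
      using add[of "0\<^sub>v 7" "0\<^sub>v 7" k] by simp
    then show ?thesis
      using F2_vec_add_self[OF companion_pow_closed[of "0\<^sub>v 7" k]] by simp
  qed
  have "(companion ^^ k) (c \<cdot>\<^sub>v v) = c \<cdot>\<^sub>v (companion ^^ k) v" if v: "v \<in> F2_space 7" for k c v
  proof (cases "c = 0")
    case True
    have "0 \<cdot>\<^sub>v w = 0\<^sub>v 7" if "w \<in> F2_space 7" for w :: "bit vec"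
      using that by (intro eq_vecI) auto
    then show ?thesis using True v zero companion_pow_closed by simp
  next
    case False
    moreover have "1 \<cdot>\<^sub>v w = w" for w :: "bit vec" by (intro eq_vecI) auto
    ultimately show ?thesis by (simp add: bit_not_zero_iff)
  qed
  then show "linear_action ?A 7 companion_action"
    unfolding linear_action_def companion_action_def using add by simp
  show "fixed_space ?A 7 companion_action = {0\<^sub>v 7}"
  proof
    show "fixed_space ?A 7 companion_action \<subseteq> {0\<^sub>v 7}"
    proof
      fix v assume "v \<in> fixed_space ?A 7 companion_action"
      then have v: "v \<in> F2_space 7" "companion_action 1 v = v"
        using one by (auto simp: fixed_space_def simp del: integer_mod_group_1)
      then have "companion v = v" by (simp add: companion_action_def)
      with v(1) show "v \<in> {0\<^sub>v 7}" using companion_fixed by simp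
    qed
    show "{0\<^sub>v 7} \<subseteq> fixed_space ?A 7 companion_action"
      using zero by (auto simp: fixed_space_def companion_action_def)
  qed
qed

text \<open>The orbit sizes are known for every such action of order 21, so no orbit of the concrete
  action is computed; 1 + 21 + 21 + 21 is half of 128.\<close>

lemma companion_half_sum: "half_sum_condition (integer_mod_group 21) 7 companion_action"
proof -
  obtain g where "cyclic_odd_action (integer_mod_group 21) 7 companion_action g"
    using cyclic_odd_pair_locale[OF companion_pair] .
  moreover have "order (integer_mod_group 21) = 21"
    by (simp add: order_def carrier_integer_mod_group)
  ultimately interpret order_21_action "integer_mod_group 21" companion_action g
    by (simp add: order_21_action_def order_21_action_axioms_def)
  have "{#1, 21,21,21#} \<subseteq># {#1, 3,3,3,3,3, 7, 21,21,21,21,21 :: nat#}"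
    by (simp add: subseteq_mset_def)
  then show ?thesis
    unfolding half_sum_condition_def orbit_sizes_21
    by (intro exI[of _ "{#1, 21,21,21#}"]) (simp add: card_F2_space)
qed

text \<open>The witness lives on \<open>int\<close>, since an arbitrary type \<open>'a\<close> may
  have fewer than 21 elements. The universal clauses are reduced to the locales by the choice of a
  generator.\<close>

theorem proposition3p3:
  shows
    "(\<forall>n \<le> 6. \<forall>(A :: 'a monoid) \<phi>.
        cyclic_odd_pair A n \<phi> \<longrightarrow> \<not> half_sum_condition A n \<phi>) \<and>
     (\<exists>(A :: int monoid) \<phi>. cyclic_odd_pair A 7 \<phi> \<and> half_sum_condition A 7 \<phi>) \<and>
     (\<forall>(A :: 'a monoid) \<phi>. cyclic_odd_pair A 7 \<phi> \<longrightarrow>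
        (half_sum_condition A 7 \<phi> \<longrightarrow> order A = 21 \<and> F4_F4_F8_decomposition A 7 \<phi>) \<and>
        (order A = 21 \<and> F4_F4_F8_decomposition A 7 \<phi> \<longrightarrow>
           orbit_sizes A 7 \<phi> = {#1, 3,3,3,3,3, 7, 21,21,21,21,21#} \<and>
           {S. S \<subseteq> orbits A (F2_space 7) \<phi> \<and> (\<Sum>X\<in>S. card X) = 64} =
             {S. S \<subseteq> orbits A (F2_space 7) \<phi> \<and>
                 image_mset card (mset_set S) \<in>
                   {{#1, 21,21,21#}, {#3,3,3,3,3, 7, 21,21#}}} \<and>
           card {S. S \<subseteq> orbits A (F2_space 7) \<phi> \<and> (\<Sum>X\<in>S. card X) = 64} = 20))"
proof (intro conjI allI impI)
  fix n and A :: "'a monoid" and \<phi>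
  assume "n \<le> 6" "cyclic_odd_pair A n \<phi>"
  then obtain g where "cyclic_odd_action A n \<phi> g" using cyclic_odd_pair_locale by blast
  then interpret cyclic_odd_action A n \<phi> g .
  show "\<not> half_sum_condition A n \<phi>"
    using half_sum_order(1) \<open>n \<le> 6\<close> by auto
next
  show "\<exists>(A :: int monoid) \<phi>. cyclic_odd_pair A 7 \<phi> \<and> half_sum_condition A 7 \<phi>"
    using companion_pair companion_half_sum by blast
next
  fix A :: "'a monoid" and \<phi>
  assume pair: "cyclic_odd_pair A 7 \<phi>"
  then obtain g where g: "cyclic_odd_action A 7 \<phi> g" using cyclic_odd_pair_locale by blast
  then interpret cyclic_odd_action A 7 \<phi> g .
  have order_21: "order_21_action A \<phi> g" if "order A = 21"
    using that g by (simp add: order_21_action_def order_21_action_axioms_def)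
  {
    assume "half_sum_condition A 7 \<phi>"
    then show "order A = 21" using half_sum_order(2) by simp
    then show "F4_F4_F8_decomposition A 7 \<phi>"
      by (rule order_21_action.decomposition[OF order_21])
  next
    assume "order A = 21 \<and> F4_F4_F8_decomposition A 7 \<phi>"
    then interpret order_21_action A \<phi> g using order_21 by simp
    show "orbit_sizes A 7 \<phi> = {#1, 3,3,3,3,3, 7, 21,21,21,21,21#}"
      by (rule orbit_sizes_21)
    show "{S. S \<subseteq> orbits A (F2_space 7) \<phi> \<and> (\<Sum>X\<in>S. card X) = 64} =
        {S. S \<subseteq> orbits A (F2_space 7) \<phi> \<and>
          image_mset card (mset_set S) \<in> {{#1, 21,21,21#}, {#3,3,3,3,3, 7, 21,21#}}}"
      using sum_64_iff_sizes by blast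
    show "card {S. S \<subseteq> orbits A (F2_space 7) \<phi> \<and> (\<Sum>X\<in>S. card X) = 64} = 20"
      by (rule card_sum_64)
  }
qed

end
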